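(* Let $M$ be an Artinian generic monomial ideal in $A$, let $$0\to E_n\stackrel{\varphi_n}{\longrightarrow}\cdots\stackrel{\varphi_2}{\longrightarrow}E_1\stackrel{\varphi_1}{\longrightarrow}E_0$$ be the Scarf resolution of $A/M$, and let $\sigma$ be a permutation of $\{1,\dots,n\}$. Then $$d_\sigma\varphi:=\frac{\partial\varphi_1}{\partial z_{\sigma(1)}}dz_{\sigma(1)}\wedge\cdots\wedge\frac{\partial\varphi_n}{\partial z_{\sigma(n)}}dz_{\sigma(n)}$$ has one entry $(d_\sigma\varphi)_\alpha$ for each outer corner $\alpha$ of the staircase $S$ of $M$, and $$(d_\sigma\varphi)_\alpha=\operatorname{sgn}(\alpha)\,\operatorname{Vol}(S_{\sigma,\alpha})\,z^{\alpha-\mathbf 1}\,dz,$$ where $dz=dz_n\wedge\cdots\wedge dz_1$ and $z^{\alpha-\mathbf 1}=z_1^{\alpha_1-1}\cdots z_n^{\alpha_n-1}$ for $\alpha=(\alpha_1,\dots,\alpha_n)$.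
   Context: Ring and order. $A$ is either the polynomial ring $\mathbb C[z_1,\dots,z_n]$ or the ring $\mathcal O_0$ of germs of holomorphic functions at $0\in\mathbb C^n$ with coordinates $z_1,\dots,z_n$. For $a\in\mathbb N^n$ ($0\in\mathbb N$), $z^a=z_1^{a_1}\cdots z_n^{a_n}$. On $\mathbb R^n$, $a\ge b$ means $a_\ell\ge b_\ell$ for all $\ell$; $a\vee b$ is the componentwise maximum. Monomial ideals. A monomial ideal $M\subset A$ (an ideal generated by monomials) has a unique minimal set of monomial generators $m_1=z^{a^1},\dots,m_r=z^{a^r}$. $M$ is Artinian if among its generators there are powers $z_i^{a_i}$, $a_i>0$, for $i=1,\dots,n$. $M$ is generic if whenever two distinct minimal generators $m_i,m_j$ have the same positive degree in some variable, there is a third minimal generator $m_k$ that strictly divides $m_{\{i,j\}}:=\operatorname{lcm}(m_i,m_j)$, i.e. $m_k$ divides $m_{\{i,j\}}/z_\ell$ for every variable $z_\ell$ dividing $m_{\{i,j\}}$. Staircase. The staircase of $M$ is $S=\overline{\{x\in\mathbb R^n_{>0} : z_1^{\lfloor x_1\rfloor}\cdots z_n^{\lfloor x_n\rfloor}\notin M\}}$, the closure being taken in $\mathbb R^n_{>0}$. The finitely many maximal elements of $S$ with respect to $\ge$ are the outer corners of $S$; they lie in $\mathbb N^n$ and have positive coordinates. Partition $S_{\sigma,\alpha}$. For a permutation $\sigma$ of $\{1,\dots,n\}$, let $\ge_\sigma$ be the lexicographic order: $\alpha\ge_\sigma\beta$ iff $\alpha=\beta$ or for some $1\le k\le n$,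 $\alpha_{\sigma(\ell)}=\beta_{\sigma(\ell)}$ for $1\le\ell\le k-1$ and $\alpha_{\sigma(k)}>\beta_{\sigma(k)}$. List all outer corners as $\alpha^1\ge_\sigma\alpha^2\ge_\sigma\cdots$ and define inductively $S_{\sigma,\alpha^1}=\{x\in S: x\le\alpha^1\}$ and $S_{\sigma,\alpha^k}=\{x\in S\setminus(S_{\sigma,\alpha^1}\cup\cdots\cup S_{\sigma,\alpha^{k-1}}): x\le\alpha^k\}$. $\operatorname{Vol}$ is Euclidean volume in $\mathbb R^n$. Scarf complex. For $\mathcal I\subset\{1,\dots,r\}$ let $m_{\mathcal I}=\operatorname{lcm}(m_i: i\in\mathcal I)$ ($m_\emptyset=1$). The Scarf complex is $\Delta=\{\mathcal I\subset\{1,\dots,r\}: m_{\mathcal I}=m_{\mathcal I'}\Rightarrow\mathcal I=\mathcal I'\}$, and $\Delta(k)$ is the set of $\mathcal I\in\Delta$ with $k$ elements. The label of $\mathcal I$ is $m_{\mathcal I}$ (or its exponent). For $M$ generic Artinian, $\Delta$ is a simplicial complex of dimension $n-1$ and taking labels $\mathcal I\mapsto\alpha$, $m_{\mathcal I}=z^\alpha$, is a bijection from $\Delta(n)$ to the outer corners of $S$. Scarf resolution. For $k=0,\dots,n$, $E_k$ is the free $A$-module with basis $\{e_{\mathcal I}\}_{\mathcal I\in\Delta(k)}$ (so $E_0\cong A$ with basis $e_\emptyset$), and $\varphi_k:E_k\to E_{k-1}$ is $$\varphi_k(e_{\mathcal I})=\sum_{j=1}^k(-1)^{j-1}\frac{m_{\mathcal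 I}}{m_{\mathcal I_j}}e_{\mathcal I_j},\qquad \mathcal I=\{i_1<\cdots<i_k\},\ \mathcal I_j=\mathcal I\setminus\{i_j\}.$$ For generic Artinian $M$ this is a (minimal) free resolution of $A/M$, the Scarf resolution. The form. $\partial\varphi_k/\partial z_\ell$ is the matrix (in the bases $\{e_{\mathcal I}\}_{\mathcal I\in\Delta(k)}$ of $E_k$ and $\{e_{\mathcal J}\}_{\mathcal J\in\Delta(k-1)}$ of $E_{k-1}$) of entrywise partial derivatives of $\varphi_k$; products of form-valued matrices are matrix products with entries multiplied by the wedge product in the given order. Thus $d_\sigma\varphi$ is an $n$-form with values in $\operatorname{Hom}(E_n,E_0)\cong E_n^*$, and $(d_\sigma\varphi)_\alpha$ denotes its coefficient at $e_{\mathcal I}^*$, where $\mathcal I\in\Delta(n)$ has label $\alpha$. Sign. Let $\mathcal I=\{i_1<\cdots<i_n\}\in\Delta(n)$ have label $\alpha$. For $M$ generic, for each $\ell\in\{1,\dots,n\}$ there is exactly one vertex $i\in\mathcal I$ with $a^{i}_\ell=\alpha_\ell$, and there is a unique permutation $\eta$ of $\{1,\dots,n\}$ with $a^{i_{\eta(\ell)}}_\ell=\alpha_\ell$ for all $\ell$. Then $\operatorname{sgn}(\alpha):=\operatorname{sgn}(\eta)$. *)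

theory Defs
  imports
    "HOL-Analysis.Analysis"
    "HOL-Library.Poly_Mapping"
    "HOL-Combinatorics.Permutations"
begin

section \<open>The two rings\<close>

text \<open>
  The variables $z_1,\dots,z_n$ are indexed by a finite linearly ordered type \<open>'n\<close>, so that
  $n$ is \<open>CARD('n)\<close>; the elements of \<open>'n\<close> are enumerated increasingly by \<open>var 1\<close>, ..., \<open>var n\<close>.
  The order is needed because the sign conventions of the theorem identify the positions
  $1,\dots,n$ in a product, or in an \<open>n\<close>-element face, with the variables.
\<close>

definition nth_elem :: "'i::linorder set \<Rightarrow> nat \<Rightarrow> 'i" where
  "nth_elem I k = sorted_list_of_set I ! (k - 1)"

definition var :: "nat \<Rightarrow> 'n::{finite,linorder}" where
  "var k = nth_elem UNIV k"

definition var_index :: "'n::{finite,linorder} \<Rightarrow> nat" where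
  "var_index i = card {j. j \<le> i}"

text \<open>
  Besides the ring structure (given by the type class of \<open>'a\<close>), the theorem uses the embedding of
  the constants, the coordinates and the partial derivatives.
\<close>

record ('n, 'a) coord_ring =
  scalar :: "complex \<Rightarrow> 'a"
  coord :: "'n \<Rightarrow> 'a"
  pdiff :: "'n \<Rightarrow> 'a \<Rightarrow> 'a"

subsection \<open>Polynomials\<close>

type_synonym 'n mpoly = "('n \<Rightarrow>\<^sub>0 nat) \<Rightarrow>\<^sub>0 complex"

definition mpoly_pdiff :: "'n \<Rightarrow> 'n mpoly \<Rightarrow> 'n mpoly" where
  "mpoly_pdiff i p =
     (\<Sum>m\<in>Poly_Mapping.keys p.
        Poly_Mapping.single (m - Poly_Mapping.single i 1)
          (of_nat (Poly_Mapping.lookup m i) * Poly_Mapping.lookup p m))"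

definition polynomial_ring :: "('n, 'n mpoly) coord_ring" where
  "polynomial_ring =
     \<lparr>scalar = Poly_Mapping.single 0,
      coord = (\<lambda>i. Poly_Mapping.single (Poly_Mapping.single i 1) 1),
      pdiff = mpoly_pdiff\<rparr>"

subsection \<open>Germs of holomorphic functions at the origin\<close>

definition holomorphic_near_0 :: "(complex^'n::finite \<Rightarrow> complex) \<Rightarrow> bool" where
  "holomorphic_near_0 f \<longleftrightarrow>
     (\<forall>\<^sub>F z in nhds 0. \<exists>f'. (f has_derivative f') (at z) \<and> (\<forall>c v. f' (c *s v) = c * f' v))"

definition germ_rel :: "(complex^'n::finite \<Rightarrow> complex) \<Rightarrow> (complex^'n \<Rightarrow> complex) \<Rightarrow> bool" where
  "germ_rel f g \<longleftrightarrow>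
     holomorphic_near_0 f \<and> holomorphic_near_0 g \<and> (\<forall>\<^sub>F z in nhds 0. f z = g z)"

lemma holomorphic_near_0_const: "holomorphic_near_0 (\<lambda>z::complex^'n::finite. c)"
  unfolding holomorphic_near_0_def
  by (rule always_eventually, rule allI, rule exI[of _ "\<lambda>_. 0"]) simp

lemma holomorphic_near_0_coord: "holomorphic_near_0 (\<lambda>z::complex^'n::finite. z $ i)"
  unfolding holomorphic_near_0_def
  by (rule always_eventually, rule allI, rule exI[of _ "\<lambda>v. v $ i"])
     (auto intro!: bounded_linear_imp_has_derivative bounded_linear_vec_nth)

lemma holomorphic_near_0_add:
  assumes "holomorphic_near_0 f" "holomorphic_near_0 g"
  shows "holomorphic_near_0 (\<lambda>z::complex^'n::finite. f z + g z)"
  using assms unfolding holomorphic_near_0_def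
proof eventually_elim
  case (elim z)
  then obtain f' g' where "(f has_derivative f') (at z)" "\<forall>c v. f' (c *s v) = c * f' v"
    "(g has_derivative g') (at z)" "\<forall>c v. g' (c *s v) = c * g' v" by auto
  then show ?case
    by (intro exI[of _ "\<lambda>v. f' v + g' v"]) (auto intro!: has_derivative_add simp: algebra_simps)
qed

lemma holomorphic_near_0_mult:
  assumes "holomorphic_near_0 f" "holomorphic_near_0 g"
  shows "holomorphic_near_0 (\<lambda>z::complex^'n::finite. f z * g z)"
  using assms unfolding holomorphic_near_0_def
proof eventually_elim
  case (elim z)
  then obtain f' g' where "(f has_derivative f') (at z)" "\<forall>c v. f' (c *s v) = c * f' v"
    "(g has_derivative g') (at z)" "\<forall>c v. g' (c *s v) = c * g' v" by auto
  then show ?case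
    by (intro exI[of _ "\<lambda>v. f z * g' v + f' v * g z"])
       (auto intro!: has_derivative_mult simp: algebra_simps)
qed

lemma holomorphic_near_0_minus:
  assumes "holomorphic_near_0 f"
  shows "holomorphic_near_0 (\<lambda>z::complex^'n::finite. - f z)"
  using holomorphic_near_0_mult[OF holomorphic_near_0_const[of "-1"] assms] by simp

quotient_type 'n hol_germ = "complex^'n::finite \<Rightarrow> complex" / partial: germ_rel
proof (rule part_equivpI)
  show "\<exists>f::complex^'n::finite \<Rightarrow> complex. germ_rel f f"
    by (rule exI[of _ "\<lambda>_. 0"]) (simp add: germ_rel_def holomorphic_near_0_const)
  show "symp (germ_rel :: (complex^'n::finite \<Rightarrow> complex) \<Rightarrow> _)"
    by (rule sympI) (auto simp: germ_rel_def eq_commute)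
  show "transp (germ_rel :: (complex^'n::finite \<Rightarrow> complex) \<Rightarrow> _)"
    by (rule transpI) (auto simp: germ_rel_def elim: eventually_elim2)
qed

instantiation hol_germ :: (finite) comm_ring_1
begin

lift_definition zero_hol_germ :: "'a hol_germ" is "\<lambda>_. 0"
  by (simp add: germ_rel_def holomorphic_near_0_const)

lift_definition one_hol_germ :: "'a hol_germ" is "\<lambda>_. 1"
  by (simp add: germ_rel_def holomorphic_near_0_const)

lift_definition plus_hol_germ :: "'a hol_germ \<Rightarrow> 'a hol_germ \<Rightarrow> 'a hol_germ"
  is "\<lambda>f g z. f z + g z"
  by (auto simp: germ_rel_def holomorphic_near_0_add elim: eventually_elim2)

lift_definition times_hol_germ :: "'a hol_germ \<Rightarrow> 'a hol_germ \<Rightarrow> 'a hol_germ"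
  is "\<lambda>f g z. f z * g z"
  by (auto simp: germ_rel_def holomorphic_near_0_mult elim: eventually_elim2)

lift_definition uminus_hol_germ :: "'a hol_germ \<Rightarrow> 'a hol_germ"
  is "\<lambda>f z. - f z"
  by (auto simp: germ_rel_def holomorphic_near_0_minus)

definition minus_hol_germ :: "'a hol_germ \<Rightarrow> 'a hol_germ \<Rightarrow> 'a hol_germ" where
  "minus_hol_germ f g = f + (- g)"

instance
proof
  fix a b c :: "'a hol_germ"
  show "a * b * c = a * (b * c)"
    by transfer (simp add: germ_rel_def holomorphic_near_0_mult mult.assoc)
  show "a * b = b * a"
    by transfer (simp add: germ_rel_def holomorphic_near_0_mult mult.commute)
  show "1 * a = a"
    by transfer (simp add: germ_rel_def)
  show "a + b + c = a + (b + c)"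
    by transfer (simp add: germ_rel_def holomorphic_near_0_add add.assoc)
  show "a + b = b + a"
    by transfer (simp add: germ_rel_def holomorphic_near_0_add add.commute)
  show "0 + a = a"
    by transfer (simp add: germ_rel_def)
  show "- a + a = 0"
    by transfer (simp add: germ_rel_def holomorphic_near_0_const)
  show "a - b = a + - b"
    by (simp add: minus_hol_germ_def)
  show "(a + b) * c = a * c + b * c"
    by transfer
       (simp add: germ_rel_def holomorphic_near_0_add holomorphic_near_0_mult distrib_right)
  show "(0 :: 'a hol_germ) \<noteq> 1"
    by transfer (simp add: germ_rel_def)
qed

end

lift_definition germ_scalar :: "complex \<Rightarrow> 'n::finite hol_germ" is "\<lambda>c _. c"
  by (simp add: germ_rel_def holomorphic_near_0_const)

lift_definition germ_coord :: "'n::finite \<Rightarrow> 'n hol_germ" is "\<lambda>i z. z $ i"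
  by (simp add: germ_rel_def holomorphic_near_0_coord)

text \<open>
  Partial derivatives of a holomorphic function are holomorphic, and near 0 they depend on its
  germ only, so the following does not depend on the representative and \<open>abs_hol_germ\<close> is applied
  inside its domain.
\<close>

definition germ_pdiff :: "'n::finite \<Rightarrow> 'n hol_germ \<Rightarrow> 'n hol_germ" where
  "germ_pdiff i g =
     abs_hol_germ (\<lambda>z. deriv (\<lambda>w. rep_hol_germ g (\<chi> j. if j = i then w else z $ j)) (z $ i))"

definition germ_ring :: "('n::finite, 'n hol_germ) coord_ring" where
  "germ_ring = \<lparr>scalar = germ_scalar, coord = germ_coord, pdiff = germ_pdiff\<rparr>"

section \<open>Monomial ideals\<close>

definition monomial :: "('n::finite, 'a::comm_ring_1) coord_ring \<Rightarrow> ('n \<Rightarrow> nat) \<Rightarrow> 'a" where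
  "monomial A a = (\<Prod>i\<in>UNIV. coord A i ^ a i)"

abbreviation ideal_gen :: "'a::comm_ring_1 set \<Rightarrow> 'a set" where
  "ideal_gen \<equiv> module.span (*)"

text \<open>
  \<open>minimal_generators A M r a\<close>: the monomials $z^{a^1},\dots,z^{a^r}$ are, without repetition,
  the minimal set of monomial generators of \<open>M\<close>.
\<close>

definition minimal_generators ::
    "('n::finite, 'a::comm_ring_1) coord_ring \<Rightarrow> 'a set \<Rightarrow> nat \<Rightarrow> (nat \<Rightarrow> 'n \<Rightarrow> nat) \<Rightarrow> bool" where
  "minimal_generators A M r a \<longleftrightarrow>
     inj_on a {1..r} \<and>
     ideal_gen ((\<lambda>i. monomial A (a i)) ` {1..r}) = M \<and>
     (\<forall>J. J \<subset> {1..r} \<longrightarrow> ideal_gen ((\<lambda>i. monomial A (a i)) ` J) \<noteq> M)"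

text \<open>The exponent of the least common multiple $m_{\mathcal I}$.\<close>

definition label :: "(nat \<Rightarrow> 'n \<Rightarrow> nat) \<Rightarrow> nat set \<Rightarrow> 'n \<Rightarrow> nat" where
  "label a I l = Max (insert 0 ((\<lambda>i. a i l) ` I))"

definition artinian :: "nat \<Rightarrow> (nat \<Rightarrow> 'n \<Rightarrow> nat) \<Rightarrow> bool" where
  "artinian r a \<longleftrightarrow> (\<forall>l. \<exists>i\<in>{1..r}. a i l > 0 \<and> (\<forall>l'. l' \<noteq> l \<longrightarrow> a i l' = 0))"

definition strictly_divides :: "('n \<Rightarrow> nat) \<Rightarrow> ('n \<Rightarrow> nat) \<Rightarrow> bool" where
  "strictly_divides b c \<longleftrightarrow> b \<le> c \<and> (\<forall>l. c l > 0 \<longrightarrow> b \<le> c(l := c l - 1))"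

definition generic :: "nat \<Rightarrow> (nat \<Rightarrow> 'n \<Rightarrow> nat) \<Rightarrow> bool" where
  "generic r a \<longleftrightarrow>
     (\<forall>i\<in>{1..r}. \<forall>j\<in>{1..r}. i \<noteq> j \<longrightarrow> (\<exists>l. a i l = a j l \<and> a i l > 0) \<longrightarrow>
        (\<exists>k\<in>{1..r} - {i, j}. strictly_divides (a k) (label a {i, j})))"

section \<open>The staircase and its partitions\<close>

definition staircase :: "('n::finite, 'a::comm_ring_1) coord_ring \<Rightarrow> 'a set \<Rightarrow> (real^'n) set" where
  "staircase A M =
     top_of_set {x. \<forall>i. x $ i > 0} closure_of
       {x. (\<forall>i. x $ i > 0) \<and> monomial A (\<lambda>i. nat \<lfloor>x $ i\<rfloor>) \<notin> M}"

definition outer_corners :: "(real^'n::finite) set \<Rightarrow> (real^'n) set" where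
  "outer_corners S = {\<alpha>\<in>S. \<forall>x\<in>S. \<alpha> \<le> x \<longrightarrow> x = \<alpha>}"

definition lex_ge :: "('n::{finite,linorder} \<Rightarrow> 'n) \<Rightarrow> (real, 'n) vec \<Rightarrow> (real, 'n) vec \<Rightarrow> bool" where
  "lex_ge \<sigma> \<alpha> \<beta> \<longleftrightarrow>
     \<alpha> = \<beta> \<or> (\<exists>k. (\<forall>l<k. \<alpha> $ \<sigma> l = \<beta> $ \<sigma> l) \<and> \<alpha> $ \<sigma> k > \<beta> $ \<sigma> k)"

definition corner_list :: "('n::{finite,linorder} \<Rightarrow> 'n) \<Rightarrow> (real, 'n) vec set \<Rightarrow> (real, 'n) vec list" where
  "corner_list \<sigma> S =
     (THE \<alpha>s. set \<alpha>s = outer_corners S \<and> distinct \<alpha>s \<and> sorted_wrt (lex_ge \<sigma>) \<alpha>s)"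

text \<open>
  \<open>piece S \<alpha>s k\<close> for the corner list \<open>\<alpha>s\<close> is $S_{\sigma,\alpha^{k+1}}$: list positions start at 0.
\<close>

context
  notes SUP_cong [fundef_cong]
begin

fun piece :: "(real^'n::finite) set \<Rightarrow> (real^'n) list \<Rightarrow> nat \<Rightarrow> (real^'n) set" where
  "piece S \<alpha>s k = {x \<in> S - (\<Union>j\<in>{..<k}. piece S \<alpha>s j). x \<le> \<alpha>s ! k}"

end

declare piece.simps [simp del]

definition staircase_part ::
    "('n::{finite,linorder} \<Rightarrow> 'n) \<Rightarrow> (real, 'n) vec set \<Rightarrow> (real, 'n) vec \<Rightarrow> (real, 'n) vec set" where
  "staircase_part \<sigma> S \<alpha> =
     (let \<alpha>s = corner_list \<sigma> S in piece S \<alpha>s (THE k. k < length \<alpha>s \<and> \<alpha>s ! k = \<alpha>))"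

definition exponent_vec :: "('n \<Rightarrow> nat) \<Rightarrow> real^'n::finite" where
  "exponent_vec a = (\<chi> i. real (a i))"

section \<open>The Scarf complex and the Scarf resolution\<close>

definition scarf_complex :: "nat \<Rightarrow> (nat \<Rightarrow> 'n \<Rightarrow> nat) \<Rightarrow> nat set set" where
  "scarf_complex r a =
     {I. I \<subseteq> {1..r} \<and> (\<forall>I'. I' \<subseteq> {1..r} \<longrightarrow> label a I = label a I' \<longrightarrow> I = I')}"

definition scarf_faces :: "nat \<Rightarrow> (nat \<Rightarrow> 'n \<Rightarrow> nat) \<Rightarrow> nat \<Rightarrow> nat set set" where
  "scarf_faces r a k = {I \<in> scarf_complex r a. card I = k}"

text \<open>
  \<open>scarf_map A a k J I\<close> is the coefficient at $e_J$ of $\varphi_k(e_I)$, for \<open>I\<close> in $\Delta(k)$ and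
  \<open>J\<close> in $\Delta(k-1)$.
\<close>

definition scarf_map ::
    "('n::finite, 'a::comm_ring_1) coord_ring \<Rightarrow> (nat \<Rightarrow> 'n \<Rightarrow> nat) \<Rightarrow> nat \<Rightarrow>
     nat set \<Rightarrow> nat set \<Rightarrow> 'a" where
  "scarf_map A a k J I =
     (\<Sum>j=1..k. if J = I - {nth_elem I j}
               then (-1) ^ (j - 1) * monomial A (\<lambda>l. label a I l - label a J l) else 0)"

text \<open>
  The sign of the permutation $\eta$ for which the vertex in position $\eta(l)$ of \<open>I\<close> attains the
  label in the variable $l$.
\<close>

definition scarf_sign :: "(nat \<Rightarrow> 'n::{finite,linorder} \<Rightarrow> nat) \<Rightarrow> nat set \<Rightarrow> int" where
  "scarf_sign a I =
     sign (THE \<eta>::'n \<Rightarrow> 'n. \<eta> permutes UNIV \<and>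
       (\<forall>l. a (nth_elem I (var_index (\<eta> l))) l = label a I l))"

section \<open>Differential forms\<close>

text \<open>
  A form with coefficients in the ring is the family of its coefficients: the value at
  \<open>K = {i_1 < ... < i_p}\<close> is the coefficient at $dz_{i_1}\wedge\dots\wedge dz_{i_p}$.
\<close>

type_synonym ('n, 'a) form = "'n set \<Rightarrow> 'a"

definition form_one :: "('n, 'a::comm_ring_1) form" where
  "form_one K = (if K = {} then 1 else 0)"

definition form_d :: "'n \<Rightarrow> ('n, 'a::comm_ring_1) form" where
  "form_d i K = (if K = {i} then 1 else 0)"

definition form_smult :: "'a::comm_ring_1 \<Rightarrow> ('n, 'a) form \<Rightarrow> ('n, 'a) form" where
  "form_smult c \<omega> K = c * \<omega> K"

definition wedge ::
    "('n::{finite,linorder}, 'a::comm_ring_1) form \<Rightarrow> ('n, 'a) form \<Rightarrow> ('n, 'a) form" where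
  "wedge \<omega> \<theta> K =
     (\<Sum>I\<in>Pow K. (-1) ^ card {(i, j). i \<in> I \<and> j \<in> K - I \<and> j < i} * \<omega> I * \<theta> (K - I))"

text \<open>The form $dz = dz_n\wedge\dots\wedge dz_1$.\<close>

definition dz :: "('n::{finite,linorder}, 'a::comm_ring_1) form" where
  "dz = foldr (\<lambda>i \<omega>. wedge (form_d i) \<omega>) (rev (sorted_list_of_set UNIV)) form_one"

text \<open>
  \<open>scarf_dprod A \<sigma> r a k J I\<close> is the entry, in row $J\in\Delta(0)$ and column $I\in\Delta(k)$, of
  the product of the form-valued matrices
  $\partial\varphi_i/\partial z_{\sigma(i)}\,dz_{\sigma(i)}$ for $i = 1,\dots,k$.
\<close>

primrec scarf_dprod ::
    "('n::{finite,linorder}, 'a::comm_ring_1) coord_ring \<Rightarrow> ('n \<Rightarrow> 'n) \<Rightarrow> nat \<Rightarrow>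
     (nat \<Rightarrow> 'n \<Rightarrow> nat) \<Rightarrow> nat \<Rightarrow> nat set \<Rightarrow> nat set \<Rightarrow> ('n, 'a) form" where
  "scarf_dprod A \<sigma> r a 0 J I = (if J = I then form_one else (\<lambda>_. 0))"
| "scarf_dprod A \<sigma> r a (Suc k) J I =
     (\<lambda>L. \<Sum>K\<in>scarf_faces r a k.
        wedge (scarf_dprod A \<sigma> r a k J K)
          (form_smult (pdiff A (\<sigma> (var (Suc k))) (scarf_map A a (Suc k) K I))
            (form_d (\<sigma> (var (Suc k))))) L)"

text \<open>$(d_\sigma\varphi)_\alpha$ for the label $\alpha$ of the face \<open>I\<close>.\<close>

definition scarf_dform ::
    "('n::{finite,linorder}, 'a::comm_ring_1) coord_ring \<Rightarrow> ('n \<Rightarrow> 'n) \<Rightarrow> nat \<Rightarrow>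
     (nat \<Rightarrow> 'n \<Rightarrow> nat) \<Rightarrow> nat set \<Rightarrow> ('n, 'a) form" where
  "scarf_dform A \<sigma> r a I = scarf_dprod A \<sigma> r a CARD('n) {} I"

end

theory Submission
  imports Defs "HOL-Complex_Analysis.Cauchy_Integral_Formula"
begin

text \<open>
  Fix a facet \<open>I\<close> of the Scarf complex with label \<open>\<alpha>\<close> and write \<open>v l\<close> for its vertex attaining
  \<open>\<alpha>\<close> in the variable \<open>l\<close>. The product of the matrices expands into a sum over chains of faces of
  \<open>I\<close>. Going down from \<open>I\<close>, differentiating the last map with respect to \<open>z\<^sub>\<sigma>\<^sub>(\<^sub>n\<^sub>)\<close> kills every
  entry except the one removing \<open>v (\<sigma> n)\<close>, because only that removal lowers the label in the
  variable \<open>\<sigma> n\<close>; repeating this leaves a single chain. Its coefficient is, up to sign, the product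
  over \<open>k\<close> of the jumps of the label in the variable \<open>\<sigma> k\<close> when \<open>v (\<sigma> k)\<close> is added to
  \<open>{v (\<sigma> j) | j < k}\<close>. On the other side, genericity shows that a point \<open>x \<le> \<alpha>\<close> of the staircase
  lies below a lexicographically larger outer corner iff \<open>x\<close> is dominated in some variable \<open>\<sigma> k\<close> by
  one of the \<open>v (\<sigma> j)\<close> with \<open>j < k\<close>. So the part of the staircase belonging to \<open>\<alpha>\<close> is a half-open
  box with exactly these jumps as side lengths.
\<close>

section \<open>Signs of permutations and inversions\<close>

text \<open>Three signs meet. The boundary map attaches to a removed vertex the parity of the number
  of smaller vertices, so the chain contributes the non-inversions of
  \<open>\<eta> \<circ> \<sigma>\<close>; sorting the differentials, taken in the order prescribed
  by \<sigma>, contributes the inversions of \<sigma>; and \<open>dz\<close>, a product in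
  decreasing order, carries the sign of the full reversal. Inversions and non-inversions fill all
  pairs, so only the sign of \<eta> is left. The staircase is defined through membership of
  monomials in the ideal, which has to be reduced to divisibility. In a polynomial the exponents
  that occur can be read off; a germ is a class of functions, and there a finite average over roots
  of unity on small tori takes the place of a Taylor coefficient.\<close>

definition inversions :: "('i::ord \<Rightarrow> 'j::ord) \<Rightarrow> 'i set \<Rightarrow> ('i \<times> 'i) set" where
  "inversions p P = {(i, j). i \<in> P \<and> j \<in> P \<and> i < j \<and> p j < p i}"

text \<open>A product over pairs rather than a parity: multiplicativity under composition then
  becomes a reindexing of the pairs.\<close>

definition order_sign :: "('i::{finite,linorder} \<Rightarrow> 'i) \<Rightarrow> int" where
  "order_sign p = (\<Prod>(i, j)\<in>{(i, j). i < j}. if p i < p j then 1 else - 1)"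

lemma order_sign_eq_inversions:
  fixes p :: "'i::{finite,linorder} \<Rightarrow> 'i"
  assumes "inj p"
  shows "order_sign p = (- 1) ^ card (inversions p UNIV)"
proof -
  have "order_sign p = (\<Prod>x\<in>{(i, j). i < j}. if x \<in> inversions p UNIV then - 1 else 1)"
    unfolding order_sign_def
  proof (intro prod.cong refl, clarify)
    fix i j :: 'i assume "i < j"
    then have "p i \<noteq> p j" using injD[OF assms] by blast
    then show "(if p i < p j then 1 else - 1 :: int) = (if (i, j) \<in> inversions p UNIV then - 1 else 1)"
      using \<open>i < j\<close> by (cases "p i < p j") (auto simp: inversions_def)
  qed
  also have "\<dots> = (- 1) ^ card ({(i, j). i < j} \<inter> inversions p UNIV)"
    by (subst prod.If_cases) (auto simp: Int_def)
  also have "{(i, j). i < j} \<inter> inversions p UNIV = inversions p UNIV"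
    by (auto simp: inversions_def)
  finally show ?thesis .
qed

text \<open>The factor \<open>g i j\<close> compares the order before and after \<open>p\<close> and
  is unchanged when \<open>i\<close> and \<open>j\<close> are swapped, so it is a function of the
  unordered pair. The injection \<open>q\<close> permutes unordered pairs; \<open>h\<close> is that
  action with each pair listed increasingly.\<close>

lemma order_sign_compose:
  fixes p q :: "'i::{finite,linorder} \<Rightarrow> 'i"
  assumes "inj p" "inj q"
  shows "order_sign (p \<circ> q) = order_sign p * order_sign q"
proof -
  let ?D = "{(i, j). i < (j::'i)}"
  define s :: "'i \<Rightarrow> 'i \<Rightarrow> int" where "s i j = (if i < j then 1 else - 1)" for i j
  define g where "g i j = s (p i) (p j) * s i j" for i j
  define h where "h = (\<lambda>(i, j). (min (q i) (q j), max (q i) (q j)))"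
  have g_sym: "g i j = g j i" if "i \<noteq> j" for i j
    using that injD[OF assms(1), of i j] by (auto simp: g_def s_def)
  have h_into: "h ` ?D \<subseteq> ?D"
  proof clarify
    fix i j i' j' :: 'i assume "i < j" "(i', j') = h (i, j)"
    moreover then have "q i \<noteq> q j" using injD[OF assms(2)] by blast
    ultimately show "i' < j'" by (auto simp: h_def min_def max_def)
  qed
  moreover have h_inj: "inj_on h ?D"
  proof (rule inj_onI, clarify)
    fix i j i' j' :: 'i assume "i < j" "i' < j'" "h (i, j) = h (i', j')"
    moreover then have "{q i, q j} = {q i', q j'}"
      by (auto simp: h_def min_def max_def split: if_splits)
    then have "{i, j} = {i', j'}"
      using inj_image_eq_iff[OF assms(2), of "{i, j}" "{i', j'}"] by simp
    ultimately show "i = i' \<and> j = j'" by (auto simp: doubleton_eq_iff)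
  qed
  ultimately have "bij_betw h ?D ?D"
    by (simp add: bij_betw_def endo_inj_surj)
  then have "(\<Prod>x\<in>?D. case x of (i, j) \<Rightarrow> g i j) = (\<Prod>x\<in>?D. case h x of (i, j) \<Rightarrow> g i j)"
    by (rule prod.reindex_bij_betw[symmetric])
  also have "\<dots> = (\<Prod>(i, j)\<in>?D. g (q i) (q j))"
  proof (intro prod.cong refl, clarify)
    fix i j :: 'i assume "i < j"
    then have "q i \<noteq> q j" using injD[OF assms(2)] by blast
    then show "(case h (i, j) of (i, j) \<Rightarrow> g i j) = g (q i) (q j)"
      using g_sym by (auto simp: h_def min_def max_def)
  qed
  finally have "(\<Prod>(i, j)\<in>?D. g i j) = (\<Prod>(i, j)\<in>?D. g (q i) (q j))" .
  moreover have "(\<Prod>(i, j)\<in>?D. g i j) = order_sign p"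
    unfolding order_sign_def by (intro prod.cong) (auto simp: g_def s_def)
  moreover have "(\<Prod>(i, j)\<in>?D. g (q i) (q j)) * order_sign q = order_sign (p \<circ> q)"
    unfolding order_sign_def prod.distrib[symmetric]
    by (intro prod.cong) (auto simp: g_def s_def)
  ultimately show ?thesis by simp
qed

text \<open>Besides \<open>(a, b)\<close> itself, each element strictly between them is inverted
  with both \<open>a\<close> and \<open>b\<close>, so the number of inversions is odd.\<close>

lemma order_sign_transpose:
  fixes a b :: "'i::{finite,linorder}"
  assumes "a < b"
  shows "order_sign (Transposition.transpose a b) = - 1"
proof -
  let ?C = "{c. a < c \<and> c < b}"
  have "inversions (Transposition.transpose a b) UNIV =
      insert (a, b) ((\<lambda>c. (a, c)) ` ?C \<union> (\<lambda>c. (c, b)) ` ?C)" (is "_ = insert _ ?X")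
    using assms by (auto simp: inversions_def Transposition.transpose_def split: if_splits)
  moreover have "(a, b) \<notin> ?X" by auto
  moreover have "card ?X = card ?C + card ?C"
    by (subst card_Un_disjoint) (auto simp: card_image inj_on_def)
  ultimately show ?thesis
    by (simp add: order_sign_eq_inversions flip: mult_2)
qed

lemma order_sign_eq_sign:
  fixes p :: "'i::{finite,linorder} \<Rightarrow> 'i"
  assumes "p permutes UNIV"
  shows "order_sign p = sign p"
  using assms finite
proof (induction rule: permutes_induct)
  case id
  show ?case by (auto simp: order_sign_def intro!: prod.neutral)
next
  case (swap a b p)
  let ?t = "Transposition.transpose a b"
  have "order_sign ?t = - 1"
    using order_sign_transpose[of a b] order_sign_transpose[of b a] \<open>a \<noteq> b\<close>
    by (metis linorder_neqE transpose_commute)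
  moreover have "sign ?t = - 1"
    using \<open>a \<noteq> b\<close> by (simp add: sign_swap_id)
  moreover have "permutation p"
    using \<open>p permutes UNIV\<close> finite by (auto simp: permutation_permutes)
  ultimately show ?case
    using swap order_sign_compose[OF inj_transpose[of a b] permutes_inj[OF \<open>p permutes UNIV\<close>]]
      sign_compose[OF permutation_swap_id[of a b]] by metis
qed

lemma sign_eq_inversions:
  fixes p :: "'i::{finite,linorder} \<Rightarrow> 'i"
  assumes "p permutes UNIV"
  shows "sign p = (- 1) ^ card (inversions p UNIV)"
  using order_sign_eq_sign[OF assms] order_sign_eq_inversions[OF permutes_inj[OF assms]] by simp

text \<open>The left side is the sign produced by the expansion, the last factor on the right is the
  sign of \<open>dz\<close>. The pairs \<open>i < j\<close> split into inversions and non-inversions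
  of \<open>\<eta> \<circ> \<sigma>\<close>, and multiplicativity of \<open>sign\<close> gives the
  parity of the former.\<close>

lemma sign_noninversions:
  fixes \<eta> \<sigma> :: "'i::{finite,linorder} \<Rightarrow> 'i"
  assumes \<eta>: "\<eta> permutes UNIV" and \<sigma>: "\<sigma> permutes UNIV"
  shows "(- 1) ^ card {(i, j). i < j \<and> \<eta> (\<sigma> i) < \<eta> (\<sigma> j)} * (- 1) ^ card (inversions \<sigma> UNIV)
    = sign \<eta> * (- 1) ^ card {(i, j). i < (j::'i)}"
proof -
  let ?N = "{(i, j). i < j \<and> \<eta> (\<sigma> i) < \<eta> (\<sigma> j)}" and ?I = "inversions (\<eta> \<circ> \<sigma>) UNIV"
  have p: "(\<eta> \<circ> \<sigma>) permutes UNIV" using assms by (rule permutes_compose[rotated])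
  have "{(i, j). i < (j::'i)} = ?N \<union> ?I"
    using injD[OF permutes_inj[OF p]] by (auto simp: inversions_def) (metis linorder_neqE order.irrefl)
  moreover have "?N \<inter> ?I = {}"
    by (auto simp: inversions_def)
  ultimately have c: "card {(i, j). i < (j::'i)} = card ?N + card ?I"
    by (simp add: card_Un_disjoint)
  have "sign (\<eta> \<circ> \<sigma>) = sign \<eta> * sign \<sigma>"
    using assms by (intro sign_compose) (auto simp: permutation_permutes)
  then have "sign \<eta> * (- 1) ^ card ?I = sign \<sigma> * (sign \<eta> * sign \<eta>)"
    by (simp add: sign_eq_inversions[OF p, symmetric])
  then have *: "sign \<eta> * (- 1) ^ card ?I = (- 1) ^ card (inversions \<sigma> UNIV)"
    by (simp add: sign_eq_inversions[OF \<sigma>])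
  show ?thesis unfolding c power_add *[symmetric] by simp
qed

section \<open>Enumerations and wedge products\<close>

lemma strict_sorted_nth_elem:
  assumes "finite I" "1 \<le> j" "j < k" "k \<le> card I"
  shows "nth_elem I j < nth_elem I k"
  unfolding nth_elem_def
  by (rule sorted_wrt_nth_less[OF sorted_list_of_set.strict_sorted_key_list_of_set[of I]])
    (use assms in auto)

lemma nth_elem_image:
  assumes "finite I"
  shows "nth_elem I ` {1..card I} = I"
proof -
  have "nth_elem I ` {1..card I} = (!) (sorted_list_of_set I) ` {..<card I}"
    unfolding nth_elem_def image_image[symmetric, of _ "\<lambda>k. k - 1"]
    by (rule arg_cong[of _ _ "image _"])
       (auto simp: image_iff intro!: bexI[of _ "Suc _"])
  also have "\<dots> = I"
    using assms by (metis atLeast0LessThan length_sorted_list_of_set list.set_map map_nth set_sorted_list_of_set set_upt)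
  finally show ?thesis .
qed

text \<open>Turns the exponent \<open>j - 1\<close> of the boundary map, a position counted from 1,
  into a count of smaller vertices that can be compared between the faces of a chain.\<close>

lemma nth_elem_card_less:
  assumes "finite I" "1 \<le> k" "k \<le> card I"
  shows "card {x \<in> I. x < nth_elem I k} = k - 1"
proof -
  have "{x \<in> I. x < nth_elem I k} = nth_elem I ` {1..<k}"
  proof (intro equalityI subsetI)
    fix x assume "x \<in> {x \<in> I. x < nth_elem I k}"
    then obtain j where "j \<in> {1..card I}" "x = nth_elem I j" "x < nth_elem I k"
      using nth_elem_image[OF assms(1)] by blast
    moreover then have "j < k"
      using strict_sorted_nth_elem[OF assms(1,2), of j] assms
      by (metis atLeastAtMost_iff linorder_neqE_nat order.asym order.irrefl)
    ultimately show "x \<in> nth_elem I ` {1..<k}" by auto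
  next
    fix x assume "x \<in> nth_elem I ` {1..<k}"
    then obtain j where "1 \<le> j" "j < k" "x = nth_elem I j" by auto
    then show "x \<in> {x \<in> I. x < nth_elem I k}"
      using strict_sorted_nth_elem[OF assms(1) _ _ assms(3)] nth_elem_image[OF assms(1)] assms(3)
      by auto
  qed
  moreover have "inj_on (nth_elem I) {1..<k}"
  proof (rule linorder_inj_onI')
    fix i j assume "i \<in> {1..<k}" "j \<in> {1..<k}" "i < j"
    then show "nth_elem I i \<noteq> nth_elem I j"
      using strict_sorted_nth_elem[OF assms(1), of i j] assms(3) by auto
  qed
  ultimately show ?thesis by (simp add: card_image)
qed

definition first_vars :: "nat \<Rightarrow> 'n::{finite,linorder} set" where
  "first_vars k = var ` {1..k}"

lemma first_vars_0: "first_vars 0 = {}"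
  by (simp add: first_vars_def)

lemma first_vars_Suc: "first_vars (Suc k) = insert (var (Suc k)) (first_vars k)"
  by (simp add: first_vars_def atLeastAtMostSuc_conv)

lemma first_vars_less:
  assumes "k < CARD('n)" "i \<in> first_vars k"
  shows "i < (var (Suc k) :: 'n::{finite,linorder})"
  using assms strict_sorted_nth_elem[of "UNIV :: 'n set"] by (auto simp: first_vars_def var_def)

lemma first_vars_all: "first_vars CARD('n) = (UNIV :: 'n::{finite,linorder} set)"
  unfolding first_vars_def var_def using nth_elem_image[of "UNIV :: 'n set"] by simp

lemma first_vars_eq_less:
  assumes "k < CARD('n)"
  shows "first_vars k = {i. i < (var (Suc k) :: 'n::{finite,linorder})}"
proof (intro equalityI subsetI)
  fix i :: 'n assume "i \<in> {i. i < var (Suc k)}"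
  moreover obtain j where j: "j \<in> {1..CARD('n)}" "i = var j"
    using first_vars_all[where 'n='n] unfolding first_vars_def by blast
  ultimately have "\<not> Suc k < j" "j \<noteq> Suc k"
    using strict_sorted_nth_elem[of "UNIV :: 'n set" "Suc k" j] by (auto simp: var_def)
  then show "i \<in> first_vars k" using j by (auto simp: first_vars_def)
qed (use first_vars_less[OF assms] in auto)

text \<open>An order isomorphism from the variables, read as positions, to the vertices of a facet.
  Through it comparisons of vertices become comparisons of values of the permutation in
  \<open>scarf_sign\<close>.\<close>

lemma nth_elem_var_index:
  assumes "finite I" "card I = CARD('n)"
  shows "bij_betw (\<lambda>l::'n::{finite,linorder}. nth_elem I (var_index l)) UNIV I"
    and "strict_mono (\<lambda>l::'n. nth_elem I (var_index l))"
proof -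
  have bnd: "1 \<le> var_index l" "var_index l \<le> card I" for l :: 'n
    using assms(2) card_gt_0_iff[of "{j. j \<le> l}"]
    by (auto simp: var_index_def card_mono Suc_le_eq)
  have less: "var_index i < var_index j" if "i < j" for i j :: 'n
    unfolding var_index_def using that by (intro psubset_card_mono psubsetI) (auto dest!: equalityD2[THEN subsetD, of _ _ j])
  show mono: "strict_mono (\<lambda>l::'n. nth_elem I (var_index l))"
    using bnd less by (intro strict_monoI strict_sorted_nth_elem assms(1))
  have "(\<lambda>l::'n. nth_elem I (var_index l)) ` UNIV \<subseteq> I"
    using nth_elem_image[OF assms(1)] bnd by fastforce
  moreover have inj: "inj (\<lambda>l::'n. nth_elem I (var_index l))"
    using mono by (rule strict_mono_imp_inj_on)
  ultimately show "bij_betw (\<lambda>l::'n. nth_elem I (var_index l)) UNIV I"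
    using assms by (simp add: bij_betw_def card_image card_subset_eq)
qed

text \<open>A form whose only coefficient sits at \<open>P\<close> keeps this shape: the only
  splitting of \<open>K\<close> that contributes is into \<open>P\<close> and \<open>{s}\<close>.
  The sign counts the members of \<open>P\<close> that \<open>s\<close> has to pass to reach its
  place in increasing order.\<close>

lemma wedge_form_d_right:
  fixes \<omega> :: "('n::{finite,linorder}, 'a::comm_ring_1) form"
  assumes \<omega>: "\<And>K. K \<noteq> P \<Longrightarrow> \<omega> K = 0" and "s \<notin> P"
  shows "wedge \<omega> (form_smult c (form_d s)) K =
    (if K = insert s P then (- 1) ^ card {i \<in> P. s < i} * c * \<omega> P else 0)"
proof -
  let ?t = "\<lambda>I. (- 1) ^ card {(i, j). i \<in> I \<and> j \<in> K - I \<and> j < i} * \<omega> I * form_smult c (form_d s) (K - I)"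
  have z: "?t I = 0" if "I \<subseteq> K" "\<not> (I = P \<and> K = insert s P)" for I
  proof (cases "I = P")
    case True
    then have "K - I \<noteq> {s}" using that by blast
    then show ?thesis by (simp add: form_smult_def form_d_def)
  next
    case False
    then show ?thesis by (simp add: \<omega>)
  qed
  show ?thesis
  proof (cases "K = insert s P")
    case False
    have "wedge \<omega> (form_smult c (form_d s)) K = 0"
      unfolding wedge_def by (rule sum.neutral, rule ballI, rule z) (use False in auto)
    then show ?thesis using False by simp
  next
    case True
    have "wedge \<omega> (form_smult c (form_d s)) K = (\<Sum>I\<in>{P}. ?t I)"
      unfolding wedge_def using True z by (intro sum.mono_neutral_right) auto
    moreover have "insert s P - P = {s}" using \<open>s \<notin> P\<close> by auto
    moreover have "{(i, j). i \<in> P \<and> j = s \<and> j < i} = (\<lambda>i. (i, s)) ` {i \<in> P. s < i}" by auto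
    moreover then have "card {(i, j). i \<in> P \<and> j = s \<and> j < i} = card {i \<in> P. s < i}"
      by (simp add: card_image inj_on_def)
    ultimately show ?thesis using True by (simp add: form_smult_def form_d_def)
  qed
qed

lemma wedge_form_d_left:
  fixes \<omega> :: "('n::{finite,linorder}, 'a::comm_ring_1) form"
  assumes \<omega>: "\<And>K. K \<noteq> P \<Longrightarrow> \<omega> K = 0" and "s \<notin> P"
  shows "wedge (form_d s) \<omega> K =
    (if K = insert s P then (- 1) ^ card {i \<in> P. i < s} * \<omega> P else 0)"
proof -
  let ?t = "\<lambda>I. (- 1) ^ card {(i, j). i \<in> I \<and> j \<in> K - I \<and> j < i} * form_d s I * \<omega> (K - I)"
  have z: "?t I = 0" if "I \<subseteq> K" "\<not> (I = {s} \<and> K = insert s P)" for I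
  proof (cases "I = {s}")
    case True
    then have "K - I \<noteq> P" using that by blast
    then show ?thesis by (simp add: \<omega>)
  next
    case False
    then show ?thesis by (simp add: form_d_def)
  qed
  show ?thesis
  proof (cases "K = insert s P")
    case False
    have "wedge (form_d s) \<omega> K = 0"
      unfolding wedge_def by (rule sum.neutral, rule ballI, rule z) (use False in auto)
    then show ?thesis using False by simp
  next
    case True
    have "wedge (form_d s) \<omega> K = (\<Sum>I\<in>{{s}}. ?t I)"
      unfolding wedge_def using True z by (intro sum.mono_neutral_right) auto
    moreover have "insert s P - {s} = P" using \<open>s \<notin> P\<close> by auto
    moreover have "{(i, j). i = s \<and> j \<in> P \<and> j < i} = (\<lambda>j. (s, j)) ` {i \<in> P. i < s}" by auto
    moreover then have "card {(i, j). i = s \<and> j \<in> P \<and> j < i} = card {i \<in> P. i < s}"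
      by (simp add: card_image inj_on_def)
    ultimately show ?thesis using True by (simp add: form_d_def)
  qed
qed

text \<open>Pair counts grow one element at a time. The relation \<open>R\<close> is left open
  because the same recursion serves the sign of \<open>dz\<close>, the comparison of vertices and
  the comparison of variables.\<close>

lemma card_pairs_insert:
  assumes "finite P" "x \<notin> P"
  shows "card {(i, j). i \<in> insert x P \<and> j \<in> insert x P \<and> i < j \<and> R i j} =
    card {(i, j). i \<in> P \<and> j \<in> P \<and> i < j \<and> R i j} +
    card {i \<in> P. i < x \<and> R i x} + card {j \<in> P. x < j \<and> R x (j::'i::linorder)}"
proof -
  let ?A = "{(i, j). i \<in> P \<and> j \<in> P \<and> i < j \<and> R i j}"
  let ?B = "{i \<in> P. i < x \<and> R i x}" and ?C = "{j \<in> P. x < j \<and> R x j}"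
  have "{(i, j). i \<in> insert x P \<and> j \<in> insert x P \<and> i < j \<and> R i j} =
      ?A \<union> (\<lambda>i. (i, x)) ` ?B \<union> (\<lambda>j. (x, j)) ` ?C" using assms(2) by auto
  moreover have "finite ?A"
    by (rule finite_subset[of _ "P \<times> P"]) (use assms(1) in auto)
  moreover have "(?A \<union> (\<lambda>i. (i, x)) ` ?B) \<inter> (\<lambda>j. (x, j)) ` ?C = {}" "?A \<inter> (\<lambda>i. (i, x)) ` ?B = {}"
    using assms(2) by auto
  ultimately show ?thesis
    using assms(1) by (simp add: card_Un_disjoint card_image inj_on_def)
qed

text \<open>Each new factor on the left exceeds all the others, so sorting moves it past every one
  of them; over the whole list every pair is interchanged once.\<close>

lemma foldr_wedge_form_d:
  assumes "sorted_wrt (>) xs"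
  shows "foldr (\<lambda>i \<omega>. wedge (form_d i) \<omega>) xs form_one =
    (\<lambda>K. if K = set xs then (- 1) ^ card {(i, j). i \<in> set xs \<and> j \<in> set xs \<and> i < j} else
      (0 :: 'a::comm_ring_1))"
  using assms
proof (induction xs)
  case Nil
  show ?case by (auto simp: form_one_def fun_eq_iff)
next
  case (Cons x xs)
  then have x: "x \<notin> set xs" "\<And>i. i \<in> set xs \<Longrightarrow> i < x" by auto
  let ?\<omega> = "\<lambda>K. if K = set xs then (- 1) ^ card {(i, j). i \<in> set xs \<and> j \<in> set xs \<and> i < j} else (0 :: 'a)"
  have e: "{i \<in> set xs. i < x} = set xs" "{j \<in> set xs. x < j} = {}"
    using x by (auto dest: order.asym)
  have "wedge (form_d x) ?\<omega> =
      (\<lambda>K. if K = insert x (set xs) then (- 1) ^ card (set xs) * ?\<omega> (set xs) else 0)"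
    using wedge_form_d_left[of "set xs" ?\<omega> x] x(1) e by (auto simp: fun_eq_iff)
  moreover have "card {(i, j). i \<in> set (x # xs) \<and> j \<in> set (x # xs) \<and> i < j} =
      card {(i, j). i \<in> set xs \<and> j \<in> set xs \<and> i < j} + card (set xs)"
    using card_pairs_insert[of "set xs" x "\<lambda>_ _. True"] x(1) e by simp
  moreover have "foldr (\<lambda>i \<omega>. wedge (form_d i) \<omega>) xs form_one = ?\<omega>"
    using Cons by simp
  ultimately show ?case
    by (simp add: power_add mult.commute cong: if_cong)
qed

lemma dz_eq:
  "dz = (\<lambda>K :: 'n set. if K = UNIV then (- 1) ^ card {(i, j). i < (j::'n::{finite,linorder})} else
    (0 :: 'a::comm_ring_1))"
proof -
  have "set (rev (sorted_list_of_set UNIV)) = (UNIV :: 'n set)" by simp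
  moreover have "sorted_wrt (>) (rev (sorted_list_of_set (UNIV :: 'n set)))"
    by (simp add: sorted_wrt_rev)
  ultimately show ?thesis unfolding dz_def by (simp only: foldr_wedge_form_d) (simp cong: if_cong)
qed

section \<open>Staircases and outer corners\<close>

lemma label_le_iff:
  assumes "finite I"
  shows "label a I l \<le> m \<longleftrightarrow> (\<forall>k\<in>I. a k l \<le> m)"
  using assms by (simp add: label_def)

lemma label_ge:
  assumes "finite I" "k \<in> I"
  shows "a k l \<le> label a I l"
  using label_le_iff[OF assms(1), of a l "label a I l"] assms(2) by blast

lemma label_mono:
  assumes "finite I" "J \<subseteq> I"
  shows "label a J l \<le> label a I l"
  using assms by (meson finite_subset label_ge label_le_iff subset_iff)

lemma label_less_iff:
  assumes "finite I"
  shows "label a I l < m \<longleftrightarrow> 0 < m \<and> (\<forall>k\<in>I. a k l < m)"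
  using assms by (simp add: label_def)

lemma label_attained:
  assumes "finite I" "0 < label a I l"
  obtains k where "k \<in> I" "a k l = label a I l"
  using label_less_iff[OF assms(1), of a l "label a I l"] label_ge[OF assms(1), of _ a l] assms(2)
  by (metis le_neq_implies_less less_irrefl)

lemma label_union:
  assumes "finite I" "finite J"
  shows "label a (I \<union> J) l = max (label a I l) (label a J l)"
  by (rule antisym)
    (use assms in \<open>auto simp: label_le_iff label_mono intro: max.coboundedI1 max.coboundedI2 label_ge\<close>)

text \<open>The staircase in terms of exponents only, which makes the geometry independent of the
  ring. The closure has turned the strict condition \<open>x $ l < real (a k l)\<close> behind the
  floors into a weak one.\<close>

definition stair :: "nat \<Rightarrow> (nat \<Rightarrow> 'n \<Rightarrow> nat) \<Rightarrow> (real^'n::finite) set" where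
  "stair r a = {x. (\<forall>i. 0 < x $ i) \<and> (\<forall>k\<in>{1..r}. \<exists>l. x $ l \<le> real (a k l))}"

lemma staircase_eq_stair:
  fixes A :: "('n::finite, 'a::comm_ring_1) coord_ring"
  assumes "\<And>b. monomial A b \<in> M \<longleftrightarrow> (\<exists>k\<in>{1..r}. a k \<le> b)"
  shows "staircase A M = stair r a"
proof -
  define U :: "(real^'n) set" where "U = {x. \<forall>i. 0 < x $ i}"
  define T where "T = {x\<in>U. \<forall>k\<in>{1..r}. \<exists>l. x $ l < real (a k l)}"
  define C :: "(real^'n) set" where "C = (\<Inter>k\<in>{1..r}. \<Union>l. {x. x $ l \<le> real (a k l)})"
  have "a k \<le> (\<lambda>i. nat \<lfloor>x $ i\<rfloor>) \<longleftrightarrow> (\<forall>l. real (a k l) \<le> x $ l)" if "x \<in> U" for k x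
  proof -
    have "0 < x $ i" for i using that by (simp add: U_def)
    then have "a k l \<le> nat \<lfloor>x $ l\<rfloor> \<longleftrightarrow> real (a k l) \<le> x $ l" for l
      by (meson le_nat_floor less_imp_le of_nat_floor of_nat_le_iff order_trans)
    then show ?thesis by (simp add: le_fun_def)
  qed
  then have "{x. (\<forall>i. 0 < x $ i) \<and> monomial A (\<lambda>i. nat \<lfloor>x $ i\<rfloor>) \<notin> M} = T"
    by (auto simp: T_def assms not_le[symmetric] U_def)
  then have "staircase A M = U \<inter> closure T"
    unfolding staircase_def U_def[symmetric] closure_of_subtopology
    by (simp add: T_def Int_absorb1)
  also have "\<dots> = U \<inter> C"
  proof (intro equalityI Int_greatest Int_lower1 subsetI)
    fix x assume "x \<in> U \<inter> closure T"
    moreover have "closed C"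
      unfolding C_def by (intro closed_INT ballI closed_UN closed_halfspace_component_le_cart) auto
    moreover have "T \<subseteq> C"
      by (auto simp: T_def C_def intro: less_imp_le)
    ultimately show "x \<in> C" using closure_minimal by blast
  next
    fix x assume x: "x \<in> U \<inter> C"
    \<comment> \<open>Shrinking towards the origin makes every weak inequality strict, since the
      coordinates are positive, and stays inside the orthant.\<close>
    define y where "y n = (1 - 1 / real (n + 2)) *\<^sub>R x" for n
    have "y n \<in> T" for n
    proof -
      let ?t = "1 - 1 / real (n + 2)"
      have t: "0 < ?t" "?t < 1" by (auto simp: field_simps)
      then have "y n $ i < x $ i" "0 < y n $ i" for i
        using x by (simp_all add: y_def U_def del: of_nat_add)
      then show ?thesis using x by (fastforce simp: T_def U_def C_def intro: less_le_trans)
    qed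
    moreover have "y \<longlonglongrightarrow> (1 - 0) *\<^sub>R x"
      unfolding y_def using LIMSEQ_ignore_initial_segment[OF lim_1_over_n, of 2]
      by (intro tendsto_intros) simp
    ultimately show "x \<in> closure T" by (auto simp: closure_sequential)
  qed
  also have "\<dots> = stair r a"
    by (auto simp: U_def C_def stair_def)
  finally show ?thesis .
qed

text \<open>Maximality means that no single coordinate can be raised. The generator that prevents
  this in the variable \<open>l\<close> must agree with \<alpha> in \<open>l\<close> and stay
  strictly below it in all other variables.\<close>

lemma outer_corners_stair_iff:
  fixes a :: "nat \<Rightarrow> 'n::finite \<Rightarrow> nat"
  shows "\<alpha> \<in> outer_corners (stair r a) \<longleftrightarrow> \<alpha> \<in> stair r a \<and>
    (\<forall>l. \<exists>k\<in>{1..r}. real (a k l) = \<alpha> $ l \<and> (\<forall>i. i \<noteq> l \<longrightarrow> real (a k i) < \<alpha> $ i))"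
    (is "?L \<longleftrightarrow> ?R")
proof
  assume L: ?L
  then have S: "\<alpha> \<in> stair r a" by (simp add: outer_corners_def)
  have "\<exists>k\<in>{1..r}. real (a k l) = \<alpha> $ l \<and> (\<forall>i. i \<noteq> l \<longrightarrow> real (a k i) < \<alpha> $ i)" for l
  proof -
    \<comment> \<open>Coordinate \<open>l\<close> is raised to the next integer: an exponent below
      \<open>\<lfloor>\<alpha> $ l\<rfloor> + 1\<close> is at most
      \<open>\<alpha> $ l\<close>.\<close>
    define x where "x = (\<chi> i. if i = l then of_int (\<lfloor>\<alpha> $ l\<rfloor> + 1) else \<alpha> $ i)"
    have less: "\<alpha> $ l < x $ l" by (simp add: x_def)
    have le: "\<alpha> \<le> x" using less by (auto simp: less_eq_vec_def x_def intro: less_imp_le)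
    with L less have "x \<notin> stair r a" by (fastforce simp: outer_corners_def)
    moreover have "0 < x $ i" for i
      using le S by (auto simp: less_eq_vec_def stair_def intro: less_le_trans)
    ultimately obtain k where k: "k \<in> {1..r}" "\<And>i. real (a k i) < x $ i"
      by (auto simp: stair_def not_le)
    have "int (a k l) < \<lfloor>\<alpha> $ l\<rfloor> + 1"
      using k(2)[of l] by (simp add: x_def flip: of_int_less_iff[where 'a = real])
    then have "real (a k l) \<le> \<alpha> $ l"
      by (simp add: le_floor_iff)
    moreover have *: "real (a k i) < \<alpha> $ i" if "i \<noteq> l" for i
      using k(2)[of i] that by (simp add: x_def)
    moreover obtain i where "\<alpha> $ i \<le> real (a k i)"
      using S k(1) unfolding stair_def by blast
    ultimately show ?thesis using k(1) by (metis antisym not_le)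
  qed
  with S show ?R by blast
next
  assume R: ?R
  have "x = \<alpha>" if x: "x \<in> stair r a" "\<alpha> \<le> x" for x
  proof (rule ccontr)
    assume "x \<noteq> \<alpha>"
    then obtain l where "\<alpha> $ l < x $ l"
      using x(2) by (metis antisym_conv1 less_eq_vec_def vec_eq_iff)
    moreover obtain k where "k \<in> {1..r}" "real (a k l) = \<alpha> $ l" "\<forall>i. i \<noteq> l \<longrightarrow> real (a k i) < \<alpha> $ i"
      using R by blast
    ultimately have "\<forall>i. real (a k i) < x $ i"
      using x(2) by (metis less_eq_vec_def less_le_trans)
    then show False using x(1) \<open>k \<in> {1..r}\<close> by (auto simp: stair_def not_le[symmetric])
  qed
  with R show ?L by (simp add: outer_corners_def)
qed

lemma finite_vecs_on_grid:
  fixes F :: "'n::finite \<Rightarrow> 'b set"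
  assumes "\<And>l. finite (F l)"
  shows "finite {x. \<forall>l. x $ l \<in> F l}"
proof (rule finite_subset)
  show "{x. \<forall>l. x $ l \<in> F l} \<subseteq> vec_lambda ` Pi\<^sub>E UNIV F"
  proof
    fix x assume "x \<in> {x. \<forall>l. x $ l \<in> F l}"
    then have "vec_nth x \<in> Pi\<^sub>E UNIV F" by (simp add: PiE_UNIV_domain)
    then have "vec_lambda (vec_nth x) \<in> vec_lambda ` Pi\<^sub>E UNIV F" by (rule imageI)
    then show "x \<in> vec_lambda ` Pi\<^sub>E UNIV F" by simp
  qed
  show "finite (vec_lambda ` Pi\<^sub>E UNIV F)"
    using assms by (intro finite_imageI finite_PiE) auto
qed

lemma finite_outer_corners_stair: "finite (outer_corners (stair r a :: (real^'n::finite) set))"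
proof (rule finite_subset[OF _ finite_vecs_on_grid[of "\<lambda>l. (\<lambda>k. real (a k l)) ` {1..r}"]])
  show "outer_corners (stair r a) \<subseteq> {x. \<forall>l. x $ l \<in> (\<lambda>k. real (a k l)) ` {1..r}}"
  proof (intro subsetI CollectI allI)
    fix \<alpha> l assume "\<alpha> \<in> outer_corners (stair r a)"
    then obtain k where "k \<in> {1..r}" "real (a k l) = \<alpha> $ l"
      unfolding outer_corners_stair_iff by blast
    then show "\<alpha> $ l \<in> (\<lambda>k. real (a k l)) ` {1..r}" by (metis imageI)
  qed
qed simp

text \<open>Rounding each coordinate up to the nearest exponent of a generator stays in the
  staircase, because an exponent that bounds the old coordinate also bounds the rounded one. The
  rounded points form a finite set, so there is a maximal one above \<open>y\<close>.\<close>

lemma le_outer_corner: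
  assumes art: "artinian r a" and y: "y \<in> stair r a"
  obtains \<beta> :: "real^'n::finite" where "\<beta> \<in> outer_corners (stair r a)" "y \<le> \<beta>"
proof -
  define G where "G = {x \<in> stair r a. \<forall>l. x $ l \<in> (\<lambda>k. real (a k l)) ` {1..r}}"
  have round: "\<exists>z\<in>G. x \<le> z" if x: "x \<in> stair r a" for x
  proof -
    define F where "F l = {v \<in> (\<lambda>k. real (a k l)) ` {1..r}. x $ l \<le> v}" for l
    define z where "z = (\<chi> l. Min (F l))"
    have "finite (F l)" for l by (simp add: F_def)
    moreover have ne: "F l \<noteq> {}" for l
    proof -
      \<comment> \<open>The pure power of the variable \<open>l\<close> has exponent 0 elsewhere,
        while \<open>x\<close> is positive; so it can only bound \<open>x\<close> in the coordinate
        \<open>l\<close>, and some exponent lies above \<open>x $ l\<close>.\<close>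
      obtain k where k: "k \<in> {1..r}" "\<forall>i. i \<noteq> l \<longrightarrow> a k i = 0"
        using art unfolding artinian_def by blast
      moreover obtain i where "x $ i \<le> real (a k i)" "0 < x $ i"
        using x k(1) unfolding stair_def by blast
      ultimately have "i = l" by (metis less_le_trans less_irrefl of_nat_0)
      then show ?thesis using \<open>x $ i \<le> real (a k i)\<close> k(1) by (auto simp: F_def)
    qed
    ultimately have "Min (F l) \<in> F l" for l by simp
    then have F: "z $ l \<in> F l" for l by (simp add: z_def)
    then have xz: "x \<le> z" by (simp add: less_eq_vec_def F_def)
    have "z \<in> stair r a"
      unfolding stair_def
    proof (intro CollectI conjI allI ballI)
      show "0 < z $ i" for i
        using x xz by (auto simp: stair_def less_eq_vec_def intro: less_le_trans)
      show "\<exists>l. z $ l \<le> real (a k l)" if k: "k \<in> {1..r}" for k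
      proof -
        obtain l where "x $ l \<le> real (a k l)" using x k unfolding stair_def by blast
        then have "real (a k l) \<in> F l" using k by (simp add: F_def)
        then have "z $ l \<le> real (a k l)" using \<open>finite (F l)\<close> by (simp add: z_def)
        then show ?thesis ..
      qed
    qed
    then show ?thesis using F xz by (auto simp: G_def F_def)
  qed
  have "finite G"
    by (rule finite_subset[OF _ finite_vecs_on_grid[of "\<lambda>l. (\<lambda>k. real (a k l)) ` {1..r}"]])
      (auto simp: G_def)
  moreover obtain z where "z \<in> G" "y \<le> z" using round[OF y] by blast
  ultimately obtain \<beta> where \<beta>: "\<beta> \<in> G" "z \<le> \<beta>" "\<And>x. x \<in> G \<Longrightarrow> \<beta> \<le> x \<Longrightarrow> x = \<beta>"
    using finite_has_maximal2[of G z] by metis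
  have "x = \<beta>" if "x \<in> stair r a" "\<beta> \<le> x" for x
    using round[OF that(1)] \<beta>(3) that(2) by (metis order.antisym order.trans)
  with \<beta>(1) have "\<beta> \<in> outer_corners (stair r a)"
    by (simp add: outer_corners_def G_def)
  then show thesis using that \<open>y \<le> z\<close> \<open>z \<le> \<beta>\<close> by (blast intro: order_trans)
qed

text \<open>Were they different, genericity would supply a generator strictly dividing their lcm.
  The lcm lies below \<open>x\<close>, so that generator would be strictly below \<open>x\<close> in
  every variable, also where the lcm is 0 because \<open>x\<close> is positive; this contradicts
  membership in the staircase.\<close>

lemma generic_vertex_unique:
  assumes gen: "generic r a" and x: "x \<in> stair r a"
    and i: "i \<in> {1..r}" "\<And>l. real (a i l) \<le> x $ l" "real (a i l) = x $ l"
    and j: "j \<in> {1..r}" "\<And>l. real (a j l) \<le> x $ l" "real (a j l) = x $ l"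
  shows "i = j"
proof (rule ccontr)
  assume "i \<noteq> j"
  have pos: "0 < x $ m" for m using x by (simp add: stair_def)
  have "a i l = a j l" "0 < a i l"
    using i(3) j(3) pos[of l] by (metis of_nat_eq_iff, metis of_nat_0_less_iff)
  with gen \<open>i \<noteq> j\<close> i(1) j(1) obtain k where k: "k \<in> {1..r}" "strictly_divides (a k) (label a {i, j})"
    unfolding generic_def by blast
  obtain m where m: "x $ m \<le> real (a k m)" using x k(1) unfolding stair_def by blast
  have L: "real (label a {i, j} m) \<le> x $ m"
    using i(2)[of m] j(2)[of m] pos[of m] by (auto simp: label_def max_def)
  show False
  proof (cases "label a {i, j} m = 0")
    case True
    then have "a k m = 0" using k(2) by (auto simp: strictly_divides_def le_fun_def dest: spec[of _ m])
    then show False using m pos[of m] by simp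
  next
    case False
    then have "a k m \<le> label a {i, j} m - 1"
      using k(2) unfolding strictly_divides_def le_fun_def by (metis fun_upd_same gr0I)
    with False have "a k m < label a {i, j} m" by simp
    then show False using L m by linarith
  qed
qed

section \<open>The lexicographic partition and facets of the Scarf complex\<close>

text \<open>A point below some earlier corner lies in the piece of the first such corner, so
  removing the earlier pieces amounts to removing everything below the earlier corners.\<close>

lemma piece_eq: "piece S \<alpha>s k = {x \<in> S. x \<le> \<alpha>s ! k \<and> (\<forall>j<k. \<not> x \<le> \<alpha>s ! j)}"
proof (induction k rule: less_induct)
  case (less k)
  have "(\<exists>j<k. x \<in> piece S \<alpha>s j) \<longleftrightarrow> (\<exists>j<k. x \<le> \<alpha>s ! j)" if "x \<in> S" for x
  proof
    assume "\<exists>j<k. x \<le> \<alpha>s ! j"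
    then have "(LEAST j. x \<le> \<alpha>s ! j) < k" "x \<le> \<alpha>s ! (LEAST j. x \<le> \<alpha>s ! j)"
      by (meson Least_le le_less_trans LeastI)+
    moreover have "\<forall>i < (LEAST j. x \<le> \<alpha>s ! j). \<not> x \<le> \<alpha>s ! i"
      using not_less_Least by blast
    ultimately show "\<exists>j<k. x \<in> piece S \<alpha>s j"
      using less.IH that by blast
  qed (use less.IH in auto)
  then show ?case by (subst piece.simps) auto
qed

context
  fixes \<sigma> :: "'n::{finite,linorder} \<Rightarrow> 'n"
  assumes \<sigma>: "\<sigma> permutes UNIV"
begin

lemma first_difference:
  fixes x y :: "(real, 'n) vec"
  assumes "x \<noteq> y"
  obtains k where "\<And>l. l < k \<Longrightarrow> x $ \<sigma> l = y $ \<sigma> l" "x $ \<sigma> k \<noteq> y $ \<sigma> k"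
proof -
  let ?D = "{k. x $ \<sigma> k \<noteq> y $ \<sigma> k}"
  obtain i where "x $ i \<noteq> y $ i" using assms by (auto simp: vec_eq_iff)
  moreover obtain k where "i = \<sigma> k" using permutes_surj[OF \<sigma>] by auto
  ultimately have "?D \<noteq> {}" by auto
  then have "Min ?D \<in> ?D" by (intro Min_in) auto
  moreover have "x $ \<sigma> l = y $ \<sigma> l" if "l < Min ?D" for l
    using that Min_le[of ?D l] by fastforce
  ultimately show thesis using that by blast
qed

text \<open>With \<open>lex_ge \<sigma>\<close> in the role of the weak order, larger vectors come
  first. A linear order makes the sorted list of corners unique, which the definite description in
  \<open>corner_list\<close> relies on.\<close>

lemma linorder_lex_ge:
  "class.linorder (lex_ge \<sigma>) (\<lambda>x y :: (real, 'n) vec. lex_ge \<sigma> x y \<and> x \<noteq> y)"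
proof -
  have antisym: "x = y" if "lex_ge \<sigma> x y" "lex_ge \<sigma> y x" for x y
  proof (rule ccontr)
    assume "x \<noteq> y"
    then obtain k k' where "\<forall>l<k. x $ \<sigma> l = y $ \<sigma> l" "x $ \<sigma> k > y $ \<sigma> k"
      "\<forall>l<k'. y $ \<sigma> l = x $ \<sigma> l" "y $ \<sigma> k' > x $ \<sigma> k'"
      using \<open>lex_ge \<sigma> x y\<close> \<open>lex_ge \<sigma> y x\<close> unfolding lex_ge_def by metis
    then show False by (metis less_irrefl linorder_neqE order.asym)
  qed
  have trans: "lex_ge \<sigma> x z" if xy: "lex_ge \<sigma> x y" and yz: "lex_ge \<sigma> y z" for x y z
  proof (cases "x = y \<or> y = z")
    case True
    then show ?thesis using that by auto
  next
    case False
    then obtain k where k: "\<forall>l<k. x $ \<sigma> l = y $ \<sigma> l" "x $ \<sigma> k > y $ \<sigma> k"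
      using xy unfolding lex_ge_def by blast
    from False obtain k' where k': "\<forall>l<k'. y $ \<sigma> l = z $ \<sigma> l" "y $ \<sigma> k' > z $ \<sigma> k'"
      using yz unfolding lex_ge_def by blast
    have "\<forall>l<min k k'. x $ \<sigma> l = z $ \<sigma> l" using k(1) k'(1) by simp
    moreover have "x $ \<sigma> (min k k') > z $ \<sigma> (min k k')"
      using k k' by (cases k k' rule: linorder_cases) (auto simp: min_def)
    ultimately show ?thesis unfolding lex_ge_def by blast
  qed
  have total: "lex_ge \<sigma> x y \<or> lex_ge \<sigma> y x" for x y
  proof (cases "x = y")
    case True
    then show ?thesis by (simp add: lex_ge_def)
  next
    case False
    then obtain k where "\<And>l. l < k \<Longrightarrow> x $ \<sigma> l = y $ \<sigma> l" "x $ \<sigma> k \<noteq> y $ \<sigma> k"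
      using first_difference by blast
    then show ?thesis unfolding lex_ge_def by (metis linorder_neqE)
  qed
  show ?thesis
    by unfold_locales (use antisym trans total in \<open>auto simp: lex_ge_def[of _ x x for x]\<close>)
qed

lemma corner_list:
  fixes S :: "(real, 'n) vec set"
  assumes "finite (outer_corners S)"
  shows "set (corner_list \<sigma> S) = outer_corners S" "distinct (corner_list \<sigma> S)"
    "sorted_wrt (lex_ge \<sigma>) (corner_list \<sigma> S)"
proof -
  have "\<exists>!\<alpha>s. set \<alpha>s = outer_corners S \<and> distinct \<alpha>s \<and> sorted_wrt (lex_ge \<sigma>) \<alpha>s"
    using linorder.finite_sorted_distinct_unique[OF linorder_lex_ge assms] by metis
  from theI'[OF this] show "set (corner_list \<sigma> S) = outer_corners S" "distinct (corner_list \<sigma> S)"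
    "sorted_wrt (lex_ge \<sigma>) (corner_list \<sigma> S)"
    by (simp_all add: corner_list_def)
qed

text \<open>In a sorted list without repetition the earlier positions hold exactly the
  lexicographically larger corners, so the list can be replaced by the order.\<close>

lemma staircase_part_eq:
  fixes S :: "(real, 'n) vec set"
  assumes fin: "finite (outer_corners S)" and \<alpha>: "\<alpha> \<in> outer_corners S"
  shows "staircase_part \<sigma> S \<alpha> =
    {x \<in> S. x \<le> \<alpha> \<and> (\<forall>\<beta>\<in>outer_corners S. \<beta> \<noteq> \<alpha> \<longrightarrow> lex_ge \<sigma> \<beta> \<alpha> \<longrightarrow> \<not> x \<le> \<beta>)}"
proof -
  let ?\<alpha>s = "corner_list \<sigma> S"
  note cl = corner_list[OF fin]
  obtain k where k: "k < length ?\<alpha>s" "?\<alpha>s ! k = \<alpha>"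
    using \<alpha> cl(1) by (metis in_set_conv_nth)
  then have "(THE k. k < length ?\<alpha>s \<and> ?\<alpha>s ! k = \<alpha>) = k"
    using cl(2) nth_eq_iff_index_eq by (intro the_equality) blast+
  then have part: "staircase_part \<sigma> S \<alpha> = {x \<in> S. x \<le> \<alpha> \<and> (\<forall>j<k. \<not> x \<le> ?\<alpha>s ! j)}"
    by (simp add: staircase_part_def piece_eq k(2))
  have "{\<beta> \<in> outer_corners S. \<beta> \<noteq> \<alpha> \<and> lex_ge \<sigma> \<beta> \<alpha>} = (!) ?\<alpha>s ` {..<k}"
  proof (intro equalityI subsetI)
    fix \<beta> assume \<beta>: "\<beta> \<in> {\<beta> \<in> outer_corners S. \<beta> \<noteq> \<alpha> \<and> lex_ge \<sigma> \<beta> \<alpha>}"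
    then obtain j where j: "j < length ?\<alpha>s" "?\<alpha>s ! j = \<beta>"
      using cl(1) by (metis (no_types, lifting) in_set_conv_nth mem_Collect_eq)
    have "\<not> k < j"
    proof
      assume "k < j"
      then have "lex_ge \<sigma> \<alpha> \<beta>" using sorted_wrt_nth_less[OF cl(3) _ j(1)] k(2) j(2) by blast
      then show False using linorder_lex_ge \<beta>
        unfolding class.linorder_def class.order_def class.order_axioms_def by blast
    qed
    moreover have "j \<noteq> k" using \<beta> j k by auto
    ultimately show "\<beta> \<in> (!) ?\<alpha>s ` {..<k}" using j(2) by auto
  next
    fix \<beta> assume "\<beta> \<in> (!) ?\<alpha>s ` {..<k}"
    then obtain j where j: "j < k" "\<beta> = ?\<alpha>s ! j" by auto
    have "lex_ge \<sigma> \<beta> \<alpha>" using sorted_wrt_nth_less[OF cl(3) j(1) k(1)] j(2) k(2) by simp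
    moreover have "\<beta> \<in> outer_corners S" using j k(1) cl(1) by (metis nth_mem less_trans)
    moreover have "\<beta> \<noteq> \<alpha>" using j k cl(2) by (metis less_irrefl less_trans nth_eq_iff_index_eq)
    ultimately show "\<beta> \<in> {\<beta> \<in> outer_corners S. \<beta> \<noteq> \<alpha> \<and> lex_ge \<sigma> \<beta> \<alpha>}" by blast
  qed
  then have "(\<forall>\<beta>\<in>outer_corners S. \<beta> \<noteq> \<alpha> \<longrightarrow> lex_ge \<sigma> \<beta> \<alpha> \<longrightarrow> \<not> x \<le> \<beta>) \<longleftrightarrow>
      (\<forall>\<beta>\<in>(!) ?\<alpha>s ` {..<k}. \<not> x \<le> \<beta>)" for x
    by blast
  moreover have "(\<forall>\<beta>\<in>(!) ?\<alpha>s ` {..<k}. \<not> x \<le> \<beta>) \<longleftrightarrow> (\<forall>j<k. \<not> x \<le> ?\<alpha>s ! j)" for x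
    by auto
  ultimately show ?thesis unfolding part by (simp only:)
qed

lemma staircase_part_box:
  assumes art: "artinian r a" and gen: "generic r a"
    and \<alpha>: "\<alpha> \<in> outer_corners (stair r a)"
    and v: "\<And>l. v l \<in> {1..r}" "\<And>l. real (a (v l) l) = \<alpha> $ l"
      "\<And>l i. i \<noteq> l \<Longrightarrow> real (a (v l) i) < \<alpha> $ i"
  shows "staircase_part \<sigma> (stair r a) \<alpha> =
    {x. \<forall>k. real (label a (v ` \<sigma> ` {..<k}) (\<sigma> k)) < x $ \<sigma> k \<and> x $ \<sigma> k \<le> \<alpha> $ \<sigma> k}"
proof -
  let ?S = "stair r a"
  let ?c = "\<lambda>k. label a (v ` \<sigma> ` {..<k}) (\<sigma> k)"
  have \<alpha>S: "\<alpha> \<in> ?S" using \<alpha> by (simp add: outer_corners_def)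
  have all_\<sigma>: "(\<forall>i. P i) \<longleftrightarrow> (\<forall>k. P (\<sigma> k))" for P
    using permutes_surj[OF \<sigma>] by (metis surjD)
  have \<sigma>_eq: "\<sigma> i = \<sigma> j \<longleftrightarrow> i = j" for i j
    using permutes_inj[OF \<sigma>] by (auto dest: injD)
  \<comment> \<open>\<open>label\<close> takes a maximum that includes 0, so one strict lower bound
    encodes both positivity of the coordinate and the comparison with all earlier vertices.\<close>
  have c_less: "real (?c k) < t \<longleftrightarrow> 0 < t \<and> (\<forall>j<k. real (a (v (\<sigma> j)) (\<sigma> k)) < t)" for k t
  proof -
    have "real (?c k) < t \<longleftrightarrow> int (?c k) < \<lceil>t\<rceil>"
      by (simp add: less_ceiling_iff)
    also have "\<dots> \<longleftrightarrow> ?c k < nat \<lceil>t\<rceil>" by linarith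
    also have "\<dots> \<longleftrightarrow> 0 < nat \<lceil>t\<rceil> \<and> (\<forall>j<k. a (v (\<sigma> j)) (\<sigma> k) < nat \<lceil>t\<rceil>)"
      by (subst label_less_iff) auto
    also have "\<dots> \<longleftrightarrow> 0 < t \<and> (\<forall>j<k. real (a (v (\<sigma> j)) (\<sigma> k)) < t)"
      by (simp add: zless_nat_eq_int_zless less_ceiling_iff)
    finally show ?thesis .
  qed
  have in_S: "x \<in> ?S" if "\<forall>i. 0 < x $ i" "x \<le> \<alpha>" for x
    unfolding stair_def
  proof (intro CollectI conjI ballI)
    fix k assume "k \<in> {1..r}"
    then obtain l where "\<alpha> $ l \<le> real (a k l)" using \<alpha>S unfolding stair_def by blast
    then show "\<exists>l. x $ l \<le> real (a k l)"
      using that(2) by (meson less_eq_vec_def order_trans)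
  qed (use that in blast)
  have later: "(\<exists>\<beta>\<in>outer_corners ?S. \<beta> \<noteq> \<alpha> \<and> lex_ge \<sigma> \<beta> \<alpha> \<and> x \<le> \<beta>) \<longleftrightarrow>
      (\<exists>j k. j < k \<and> x $ \<sigma> k \<le> real (a (v (\<sigma> j)) (\<sigma> k)))"
    if pos: "\<forall>i. 0 < x $ i" and x\<alpha>: "x \<le> \<alpha>" for x
  proof
    assume "\<exists>\<beta>\<in>outer_corners ?S. \<beta> \<noteq> \<alpha> \<and> lex_ge \<sigma> \<beta> \<alpha> \<and> x \<le> \<beta>"
    then obtain \<beta> j where \<beta>: "\<beta> \<in> ?S" "x \<le> \<beta>" "\<forall>i<j. \<beta> $ \<sigma> i = \<alpha> $ \<sigma> i" "\<beta> $ \<sigma> j > \<alpha> $ \<sigma> j"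
      unfolding lex_ge_def outer_corners_def by auto
    \<comment> \<open>Since \<beta> is in the staircase, \<open>v (\<sigma> j)\<close> reaches it in
      some coordinate. This is not \<open>\<sigma> j\<close>, where \<beta> exceeds \<alpha>; in any
      other coordinate \<beta> must then be smaller than \<alpha>, which can only happen after
      \<open>j\<close>, the first difference.\<close>
    then obtain l where "\<beta> $ l \<le> real (a (v (\<sigma> j)) l)"
      using v(1) unfolding stair_def by blast
    moreover obtain k where "l = \<sigma> k" using permutes_surj[OF \<sigma>] by auto
    ultimately have k: "\<beta> $ \<sigma> k \<le> real (a (v (\<sigma> j)) (\<sigma> k))" by simp
    then have "k \<noteq> j" using \<beta>(4) v(2)[of "\<sigma> j"] by auto
    then have "\<beta> $ \<sigma> k < \<alpha> $ \<sigma> k" using k v(3)[of "\<sigma> k" "\<sigma> j"] \<sigma>_eq by fastforce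
    then have "j < k" using \<beta>(3) \<open>k \<noteq> j\<close> by (metis less_irrefl linorder_neqE)
    moreover have "x $ \<sigma> k \<le> real (a (v (\<sigma> j)) (\<sigma> k))"
      using k \<beta>(2) by (meson less_eq_vec_def order_trans)
    ultimately show "\<exists>j k. j < k \<and> x $ \<sigma> k \<le> real (a (v (\<sigma> j)) (\<sigma> k))" by blast
  next
    assume "\<exists>j k. j < k \<and> x $ \<sigma> k \<le> real (a (v (\<sigma> j)) (\<sigma> k))"
    then obtain j k where jk: "j < k" "x $ \<sigma> k \<le> real (a (v (\<sigma> j)) (\<sigma> k))" by blast
    \<comment> \<open>Only \<open>v (\<sigma> j)\<close> could obstruct raising \<open>\<alpha>\<close> in the variable \<open>\<sigma> j\<close>, and it no longer does
      once the variable \<open>\<sigma> k\<close> is lowered to that of \<open>x\<close>.\<close>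
    define y where "y = (\<chi> l. if l = \<sigma> j then \<alpha> $ l + 1 / 2 else if l = \<sigma> k then x $ l else \<alpha> $ l)"
    have xy: "x \<le> y"
      using x\<alpha> by (auto simp: y_def less_eq_vec_def intro: order_trans[of _ "\<alpha> $ \<sigma> j"])
    have "y \<in> ?S"
      unfolding stair_def
    proof (intro CollectI conjI ballI allI)
      show "0 < y $ i" for i using pos xy by (auto simp: less_eq_vec_def intro: less_le_trans)
      fix i assume i: "i \<in> {1..r}"
      show "\<exists>l. y $ l \<le> real (a i l)"
      proof (rule ccontr)
        assume "\<not> ?thesis"
        then have less: "real (a i l) < y $ l" for l by (simp add: not_le)
        have le: "real (a i l) \<le> \<alpha> $ l" if "l \<noteq> \<sigma> j" for l
          using less[of l] x\<alpha> that by (auto simp: y_def less_eq_vec_def intro: less_imp_le order_trans)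
        moreover have lej: "real (a i (\<sigma> j)) \<le> \<alpha> $ \<sigma> j"
        proof -
          \<comment> \<open>The margin 1/2 is less than the gap between integers, so an exponent
            below the raised coordinate is at most the old one.\<close>
          have "real (a i (\<sigma> j)) < real (a (v (\<sigma> j)) (\<sigma> j)) + 1 / 2"
            using less[of "\<sigma> j"] v(2)[of "\<sigma> j"] by (simp add: y_def)
          then have "a i (\<sigma> j) \<le> a (v (\<sigma> j)) (\<sigma> j)" by linarith
          then show ?thesis using v(2)[of "\<sigma> j"] by simp
        qed
        moreover have lt: "real (a i l) < \<alpha> $ l" if "l \<noteq> \<sigma> j" for l
          using less[of l] x\<alpha> that by (auto simp: y_def less_eq_vec_def split: if_splits intro: less_le_trans)
        moreover obtain l where "\<alpha> $ l \<le> real (a i l)" using \<alpha>S i unfolding stair_def by blast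
        ultimately have "real (a i (\<sigma> j)) = \<alpha> $ \<sigma> j" by (metis antisym not_le)
        moreover have "real (a (v l) m) \<le> \<alpha> $ m" for l m
          using v(2)[of l] v(3)[of m l] by (cases "m = l") auto
        moreover have "real (a i l) \<le> \<alpha> $ l" for l
          using le[of l] lej by (cases "l = \<sigma> j") auto
        \<comment> \<open>By genericity \<open>v (\<sigma> j)\<close> is the only generator below
          \<alpha> that reaches it at \<open>\<sigma> j\<close>; but in the variable
          \<open>\<sigma> k\<close> this one is at least \<open>y\<close>.\<close>
        ultimately have "i = v (\<sigma> j)"
          using v(1,2)
          by (intro generic_vertex_unique[OF gen \<alpha>S i, of "\<sigma> j"]) auto
        then show False using less[of "\<sigma> k"] jk by (auto simp: y_def \<sigma>_eq split: if_splits)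
      qed
    qed
    then obtain \<beta> where \<beta>: "\<beta> \<in> outer_corners ?S" "y \<le> \<beta>" by (rule le_outer_corner[OF art])
    have y\<beta>: "y $ i \<le> \<beta> $ i" for i using \<beta>(2) by (simp add: less_eq_vec_def)
    have j\<beta>: "\<alpha> $ \<sigma> j < \<beta> $ \<sigma> j" using y\<beta>[of "\<sigma> j"] by (simp add: y_def)
    then have "\<beta> \<noteq> \<alpha>" by auto
    then obtain i where i: "\<And>l. l < i \<Longrightarrow> \<beta> $ \<sigma> l = \<alpha> $ \<sigma> l" "\<beta> $ \<sigma> i \<noteq> \<alpha> $ \<sigma> i"
      using first_difference by blast
    \<comment> \<open>The vector \<open>y\<close> can fall below \<alpha> only in the variable
      \<open>\<sigma> k\<close>, and \<open>k\<close> comes after \<open>j\<close>. So the first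
      difference between \<beta> and \<alpha>, at \<open>j\<close> or earlier, is an
      increase.\<close>
    have "i \<le> j" using i(1)[of j] j\<beta> by force
    then have "i \<noteq> k" using jk(1) by auto
    then have "\<alpha> $ \<sigma> i \<le> \<beta> $ \<sigma> i"
      using y\<beta>[of "\<sigma> i"] by (auto simp: y_def \<sigma>_eq split: if_splits)
    then have "lex_ge \<sigma> \<beta> \<alpha>" using i unfolding lex_ge_def by (metis order.not_eq_order_implies_strict)
    with \<beta> \<open>\<beta> \<noteq> \<alpha>\<close> xy show "\<exists>\<beta>\<in>outer_corners ?S. \<beta> \<noteq> \<alpha> \<and> lex_ge \<sigma> \<beta> \<alpha> \<and> x \<le> \<beta>"
      by (blast intro: order_trans)
  qed
  have "x \<in> staircase_part \<sigma> ?S \<alpha> \<longleftrightarrow>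
      (\<forall>k. real (?c k) < x $ \<sigma> k \<and> x $ \<sigma> k \<le> \<alpha> $ \<sigma> k)" for x
  proof -
    have "x \<in> staircase_part \<sigma> ?S \<alpha> \<longleftrightarrow> (\<forall>i. 0 < x $ i) \<and> x \<le> \<alpha> \<and>
        \<not> (\<exists>\<beta>\<in>outer_corners ?S. \<beta> \<noteq> \<alpha> \<and> lex_ge \<sigma> \<beta> \<alpha> \<and> x \<le> \<beta>)"
    proof -
      have "0 < x $ i" if "x \<in> ?S" for i using that by (simp add: stair_def)
      then show ?thesis
        using in_S[of x] unfolding staircase_part_eq[OF finite_outer_corners_stair \<alpha>] by blast
    qed
    also have "\<dots> \<longleftrightarrow> (\<forall>i. 0 < x $ i) \<and> x \<le> \<alpha> \<and>
        (\<forall>k. \<forall>j<k. real (a (v (\<sigma> j)) (\<sigma> k)) < x $ \<sigma> k)"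
      using later[of x] by (metis not_le)
    also have "\<dots> \<longleftrightarrow> (\<forall>k. real (?c k) < x $ \<sigma> k \<and> x $ \<sigma> k \<le> \<alpha> $ \<sigma> k)"
    proof -
      have "(\<forall>i. 0 < x $ i) \<longleftrightarrow> (\<forall>k. 0 < x $ \<sigma> k)" "x \<le> \<alpha> \<longleftrightarrow> (\<forall>k. x $ \<sigma> k \<le> \<alpha> $ \<sigma> k)"
        unfolding less_eq_vec_def by (rule all_\<sigma>)+
      then show ?thesis unfolding c_less by blast
    qed
    finally show ?thesis .
  qed
  then show ?thesis by blast
qed

end

section \<open>Lebesgue measure of the half-open box\<close>

lemma measure_half_open_box:
  fixes c d :: "real^'n::finite"
  assumes "\<And>i. c $ i \<le> d $ i"
  shows "measure lebesgue {x. \<forall>i. c $ i < x $ i \<and> x $ i \<le> d $ i} = (\<Prod>i\<in>UNIV. d $ i - c $ i)"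
proof -
  let ?H = "{x. \<forall>i. c $ i < x $ i \<and> x $ i \<le> d $ i}"
  have "?H \<subseteq> cbox c d" "box c d \<subseteq> ?H"
    by (auto simp: mem_box_cart less_imp_le)
  \<comment> \<open>What the half-open box lacks from the closed one lies outside the open box,
    hence in a null set.\<close>
  then have "negligible (cbox c d - ?H)"
    using negligible_subset[OF negligible_frontier_interval, of "cbox c d - ?H" c d] by blast
  then have "measure lebesgue (cbox c d - (cbox c d - ?H)) = measure lebesgue (cbox c d)"
    by (intro measure_Diff_null_set) (auto simp: negligible_iff_null_sets)
  moreover have "cbox c d - (cbox c d - ?H) = ?H"
    using \<open>?H \<subseteq> cbox c d\<close> by blast
  moreover have "cbox c d \<noteq> {}"
    using assms by (simp add: interval_ne_empty_cart)
  ultimately show ?thesis by (simp add: content_cbox_cart)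
qed

lemma measure_staircase_part:
  fixes \<sigma> :: "'n::{finite,linorder} \<Rightarrow> 'n"
  assumes \<sigma>: "\<sigma> permutes UNIV" and "artinian r a" "generic r a"
    and \<alpha>: "exponent_vec \<alpha> \<in> outer_corners (stair r a)"
    and v: "\<And>l. v l \<in> {1..r}" "\<And>l. a (v l) l = \<alpha> l" "\<And>l i. i \<noteq> l \<Longrightarrow> a (v l) i < \<alpha> i"
  shows "measure lebesgue (staircase_part \<sigma> (stair r a) (exponent_vec \<alpha>)) =
    real (\<Prod>k\<in>UNIV. \<alpha> (\<sigma> k) - label a (v ` \<sigma> ` {..<k}) (\<sigma> k))"
proof -
  let ?c = "\<lambda>k. label a (v ` \<sigma> ` {..<k}) (\<sigma> k)"
  \<comment> \<open>The jumps are indexed by positions \<open>k\<close>, the sides of the box by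
    coordinates \<open>i = \<sigma> k\<close>; hence the inverse.\<close>
  define c where "c = (\<chi> i. real (?c (inv \<sigma> i)))"
  have c: "c $ \<sigma> k = real (?c k)" for k
    by (simp add: c_def permutes_inverses[OF \<sigma>])
  have le: "?c k \<le> \<alpha> (\<sigma> k)" for k
  proof -
    have "a (v (\<sigma> j)) (\<sigma> k) \<le> \<alpha> (\<sigma> k)" if "j < k" for j
      using v(3)[of "\<sigma> k" "\<sigma> j"] injD[OF permutes_inj[OF \<sigma>], of k j] that by fastforce
    then show ?thesis by (auto simp: label_le_iff)
  qed
  have all_\<sigma>: "(\<forall>i. P i) \<longleftrightarrow> (\<forall>k. P (\<sigma> k))" for P
    using permutes_surj[OF \<sigma>] by (metis surjD)
  have "staircase_part \<sigma> (stair r a) (exponent_vec \<alpha>) =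
      {x. \<forall>i. c $ i < x $ i \<and> x $ i \<le> exponent_vec \<alpha> $ i}"
    unfolding all_\<sigma>[of "\<lambda>i. c $ i < x $ i \<and> x $ i \<le> exponent_vec \<alpha> $ i" for x] c
    by (rule staircase_part_box) (use assms in \<open>auto simp: exponent_vec_def\<close>)
  moreover have "\<forall>i. c $ i \<le> exponent_vec \<alpha> $ i"
    unfolding all_\<sigma>[of "\<lambda>i. c $ i \<le> exponent_vec \<alpha> $ i"] c using le by (simp add: exponent_vec_def)
  ultimately have "measure lebesgue (staircase_part \<sigma> (stair r a) (exponent_vec \<alpha>)) =
      (\<Prod>i\<in>UNIV. exponent_vec \<alpha> $ i - c $ i)"
    by (simp only: measure_half_open_box)
  also have "\<dots> = (\<Prod>k\<in>UNIV. exponent_vec \<alpha> $ \<sigma> k - c $ \<sigma> k)"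
    by (rule prod.permute[OF \<sigma>, unfolded comp_def])
  also have "\<dots> = real (\<Prod>k\<in>UNIV. \<alpha> (\<sigma> k) - ?c k)"
    using le by (simp add: c exponent_vec_def of_nat_diff)
  finally show ?thesis .
qed

section \<open>Facets of the Scarf complex and outer corners\<close>

lemma scarf_complex_subset:
  assumes I: "I \<in> scarf_complex r a" and "J \<subseteq> I"
  shows "J \<in> scarf_complex r a"
proof -
  have "I \<subseteq> {1..r}" and uniq: "\<And>I'. I' \<subseteq> {1..r} \<Longrightarrow> label a I = label a I' \<Longrightarrow> I = I'"
    using I by (auto simp: scarf_complex_def)
  then have fin: "finite I" "finite J" using assms(2) by (auto intro: finite_subset)
  have "J = J'" if J': "J' \<subseteq> {1..r}" "label a J = label a J'" for J'
  proof -
    have fin': "finite J'" using J'(1) finite_subset by blast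
    \<comment> \<open>Exchanging \<open>J\<close> for \<open>J'\<close> inside \<open>I\<close>
      keeps the label, so uniqueness for \<open>I\<close> gives back \<open>I\<close> itself; thus
      \<open>J'\<close> contains \<open>J\<close> and lies in \<open>I\<close>.\<close>
    have "label a (J' \<union> (I - J)) = label a (J \<union> (I - J))"
      using J'(2) fin fin' by (intro ext) (simp only: label_union finite_Diff)
    moreover have "J \<union> (I - J) = I" using \<open>J \<subseteq> I\<close> by blast
    ultimately have I_eq: "I = J' \<union> (I - J)"
      using uniq[of "J' \<union> (I - J)"] J'(1) \<open>I \<subseteq> {1..r}\<close> by auto
    \<comment> \<open>An extra vertex \<open>j\<close> is bounded by the label of \<open>J\<close>,
      a set without \<open>j\<close>. Dropping \<open>j\<close> from \<open>I\<close> would leave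
      the label unchanged, against uniqueness.\<close>
    have False if j: "j \<in> J'" "j \<notin> J" for j
    proof -
      have "j \<in> I" using I_eq j(1) by blast
      have "label a I l \<le> label a (I - {j}) l" for l
      proof (subst label_le_iff[OF fin(1)], intro ballI)
        fix i assume "i \<in> I"
        show "a i l \<le> label a (I - {j}) l"
        proof (cases "i = j")
          case True
          then have "a i l \<le> label a J l" using j(1) fin' J'(2) by (simp add: label_ge)
          also have "\<dots> \<le> label a (I - {j}) l"
            using \<open>J \<subseteq> I\<close> j(2) fin by (intro label_mono) auto
          finally show ?thesis .
        qed (use \<open>i \<in> I\<close> fin in \<open>auto intro: label_ge\<close>)
      qed
      then have "label a I = label a (I - {j})"
        using fin by (intro ext antisym) (auto intro: label_mono)
      then show False using uniq[of "I - {j}"] \<open>I \<subseteq> {1..r}\<close> \<open>j \<in> I\<close> by blast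
    qed
    with I_eq \<open>J \<subseteq> I\<close> show ?thesis by blast
  qed
  then show ?thesis using \<open>J \<subseteq> I\<close> \<open>I \<subseteq> {1..r}\<close> by (auto simp: scarf_complex_def)
qed

text \<open>Deleting a vertex must change the label, so each vertex is the only one to attain it in
  some variable. Choosing such a variable is injective, and with as many vertices as variables it is
  a bijection, whose inverse is \<open>v\<close>.\<close>

lemma scarf_facet_vertices:
  fixes a :: "nat \<Rightarrow> 'n::finite \<Rightarrow> nat"
  assumes "I \<in> scarf_faces r a CARD('n)"
  obtains v where "bij_betw v UNIV I" "\<And>l. a (v l) l = label a I l"
    "\<And>l i. i \<in> I \<Longrightarrow> i \<noteq> v l \<Longrightarrow> a i l < label a I l"
proof -
  have I: "I \<subseteq> {1..r}" "card I = CARD('n)"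
    and uniq: "\<And>I'. I' \<subseteq> {1..r} \<Longrightarrow> label a I = label a I' \<Longrightarrow> I = I'"
    using assms by (auto simp: scarf_faces_def scarf_complex_def)
  then have fin: "finite I" by (auto intro: finite_subset)
  have "\<exists>l. a i l = label a I l \<and> (\<forall>j\<in>I. j \<noteq> i \<longrightarrow> a j l < label a I l)" if i: "i \<in> I" for i
  proof -
    have "label a I \<noteq> label a (I - {i})"
      using uniq[of "I - {i}"] I(1) i by blast
    then obtain l where "label a I l \<noteq> label a (I - {i}) l" by blast
    then have less: "label a (I - {i}) l < label a I l"
      using label_mono[OF fin, of "I - {i}" a l] by simp
    then have "\<forall>j\<in>I. j \<noteq> i \<longrightarrow> a j l < label a I l"
      using fin by (auto simp: label_less_iff)
    moreover obtain k where "k \<in> I" "a k l = label a I l"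
      using label_attained[OF fin, of a l] less by (metis gr0I not_less_zero)
    ultimately show ?thesis by (metis less_irrefl)
  qed
  then obtain w where w: "\<And>i. i \<in> I \<Longrightarrow> a i (w i) = label a I (w i)"
    "\<And>i j. i \<in> I \<Longrightarrow> j \<in> I \<Longrightarrow> j \<noteq> i \<Longrightarrow> a j (w i) < label a I (w i)"
    by metis
  have "inj_on w I"
    by (rule inj_onI) (metis w less_irrefl)
  then have bij: "bij_betw w I UNIV"
    using I(2) fin by (simp add: bij_betw_def card_image card_subset_eq)
  let ?v = "the_inv_into I w"
  have v: "?v l \<in> I" "w (?v l) = l" for l
    using bij the_inv_into_into[of w I l I] f_the_inv_into_f[of w I l] by (auto simp: bij_betw_def)
  show thesis
    by (rule that[of ?v]) (use bij_betw_the_inv_into[OF bij] w v in metis)+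
qed

text \<open>Uniqueness of the label is used twice. If the label vanished in a variable, the vertex
  attaining it there could be dropped. A generator strictly below it everywhere could be added,
  hence would be a vertex; but every vertex attains the label somewhere.\<close>

lemma scarf_facet_outer_corner:
  fixes a :: "nat \<Rightarrow> 'n::finite \<Rightarrow> nat"
  assumes I: "I \<in> scarf_faces r a CARD('n)"
  shows "exponent_vec (label a I) \<in> outer_corners (stair r a)"
proof -
  obtain v where v: "bij_betw v UNIV I" "\<And>l. a (v l) l = label a I l"
    "\<And>l i. i \<in> I \<Longrightarrow> i \<noteq> v l \<Longrightarrow> a i l < label a I l"
    using scarf_facet_vertices[OF I] by metis
  have sub: "I \<subseteq> {1..r}" and uniq: "\<And>I'. I' \<subseteq> {1..r} \<Longrightarrow> label a I = label a I' \<Longrightarrow> I = I'"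
    using I by (auto simp: scarf_faces_def scarf_complex_def)
  then have fin: "finite I" by (auto intro: finite_subset)
  have vI: "v l \<in> I" for l using v(1) by (auto simp: bij_betw_def)
  have v_eq: "v i = v l \<longleftrightarrow> i = l" for i l using v(1) by (auto simp: bij_betw_def dest: injD)
  have pos: "0 < label a I l" for l
  proof (rule ccontr)
    assume "\<not> 0 < label a I l"
    then have l: "label a I l = 0" by simp
    have "a i j \<le> label a (I - {v l}) j" if "i \<in> I" for i j
    proof (cases "i = v l")
      case True
      show ?thesis
      proof (cases "j = l")
        case True
        then show ?thesis using \<open>i = v l\<close> v(2)[of l] l by simp
      next
        case False
        then have "a i j \<le> a (v j) j"
          using label_ge[OF fin that, of a j] v(2)[of j] by simp
        also have "\<dots> \<le> label a (I - {v l}) j"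
          using fin vI False by (intro label_ge) (auto simp: v_eq)
        finally show ?thesis .
      qed
    qed (use fin that in \<open>auto intro: label_ge\<close>)
    then have "label a I = label a (I - {v l})"
      using fin by (intro ext antisym) (auto simp: label_le_iff intro: label_ge)
    then show False using uniq[of "I - {v l}"] sub vI[of l] by blast
  qed
  have "\<exists>l. label a I l \<le> a k l" if k: "k \<in> {1..r}" for k
  proof (rule ccontr)
    assume "\<not> ?thesis"
    then have less: "a k l < label a I l" for l by (simp add: not_le)
    have "label a (insert k I) = label a I"
      using fin less
      by (intro ext antisym) (auto simp: label_le_iff intro: label_mono label_ge less_imp_le)
    then have "k \<in> I" using uniq[of "insert k I"] sub k by auto
    then obtain l where "k = v l" using v(1) by (auto simp: bij_betw_def)
    then show False using less[of l] v(2)[of l] by simp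
  qed
  then have "exponent_vec (label a I) \<in> stair r a"
    using pos by (simp add: stair_def exponent_vec_def)
  moreover have "\<exists>k\<in>{1..r}. real (a k l) = exponent_vec (label a I) $ l \<and>
      (\<forall>i. i \<noteq> l \<longrightarrow> real (a k i) < exponent_vec (label a I) $ i)" for l
    using vI[of l] sub v(2)[of l] v(3)[OF vI[of l]] v_eq
    by (intro bexI[of _ "v l"]) (auto simp: exponent_vec_def)
  ultimately show ?thesis by (simp add: outer_corners_stair_iff)
qed

text \<open>Injectivity is built into the Scarf complex. For surjectivity, the generators touching a
  corner, one per variable, form a face: a set with the same label attains it in each variable, by
  genericity at the very same generator, and each of its members reaches the corner somewhere
  because the corner lies in the staircase.\<close>

lemma bij_betw_scarf_facets:
  fixes a :: "nat \<Rightarrow> 'n::finite \<Rightarrow> nat"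
  assumes gen: "generic r a"
  shows "bij_betw (\<lambda>I. exponent_vec (label a I)) (scarf_faces r a CARD('n))
    (outer_corners (stair r a))"
proof (rule bij_betw_imageI[OF inj_onI equalityI[OF image_subsetI subsetI]])
  fix I J assume "I \<in> scarf_faces r a CARD('n)" "J \<in> scarf_faces r a CARD('n)"
    "exponent_vec (label a I) = exponent_vec (label a J)"
  moreover then have "label a I = label a J"
    by (auto simp: exponent_vec_def vec_eq_iff)
  ultimately show "I = J" by (auto simp: scarf_faces_def scarf_complex_def)
next
  fix \<alpha> assume \<alpha>: "\<alpha> \<in> outer_corners (stair r a)"
  then have S: "\<alpha> \<in> stair r a" by (simp add: outer_corners_def)
  obtain v where v: "\<And>l. v l \<in> {1..r}" "\<And>l. real (a (v l) l) = \<alpha> $ l"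
    "\<And>l i. i \<noteq> l \<Longrightarrow> real (a (v l) i) < \<alpha> $ i"
    using \<alpha> unfolding outer_corners_stair_iff by metis
  have le: "real (a (v l) i) \<le> \<alpha> $ i" for l i
    by (cases "i = l") (use v in \<open>auto intro: less_imp_le\<close>)
  have pos: "0 < \<alpha> $ l" for l using S by (simp add: stair_def)
  define I where "I = range v"
  have "inj v"
    by (rule injI) (metis v(2,3) less_irrefl)
  then have card: "card I = CARD('n)" by (simp add: I_def card_image)
  have I: "I \<subseteq> {1..r}" "finite I" using v(1) by (auto simp: I_def)
  have lab: "real (label a I l) = \<alpha> $ l" for l
  proof (rule antisym)
    have "label a I l \<le> a (v l) l"
    proof -
      have "a (v i) l \<le> a (v l) l" for i
        using le[of i l] v(2)[of l] by linarith
      then show ?thesis using I(2) by (auto simp: label_le_iff I_def)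
    qed
    then show "real (label a I l) \<le> \<alpha> $ l" using v(2)[of l] by simp
    have "a (v l) l \<le> label a I l" using I(2) by (intro label_ge) (auto simp: I_def)
    then show "\<alpha> $ l \<le> real (label a I l)" using v(2)[of l] by simp
  qed
  have "I = I'" if I': "I' \<subseteq> {1..r}" "label a I = label a I'" for I'
  proof -
    have fin': "finite I'" using I'(1) finite_subset by blast
    have le': "real (a i l) \<le> \<alpha> $ l" if "i \<in> I'" for i l
      using label_ge[OF fin' that, of a l] lab[of l] I'(2) by simp
    have vertex: "i = v l" if "i \<in> I'" "real (a i l) = \<alpha> $ l" for i l
      using generic_vertex_unique[OF gen S, of i l "v l"] that I'(1) le' le v(1,2) by blast
    have "v l \<in> I'" for l
    proof -
      have "0 < label a I' l" using pos[of l] lab[of l] I'(2) by simp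
      then obtain i where "i \<in> I'" "a i l = label a I' l" by (rule label_attained[OF fin'])
      then show ?thesis using vertex[of i l] lab[of l] I'(2) by simp
    qed
    moreover have "i \<in> I" if i: "i \<in> I'" for i
    proof -
      obtain l where "\<alpha> $ l \<le> real (a i l)"
        using S subsetD[OF I'(1) i] unfolding stair_def by blast
      then have "i = v l" using vertex[OF i] le'[OF i, of l] by (simp add: antisym)
      then show ?thesis by (simp add: I_def)
    qed
    ultimately show ?thesis by (auto simp: I_def)
  qed
  then have "I \<in> scarf_faces r a CARD('n)"
    using I card by (auto simp: scarf_faces_def scarf_complex_def)
  moreover have "exponent_vec (label a I) = \<alpha>"
    using lab by (simp add: exponent_vec_def vec_eq_iff)
  ultimately show "\<alpha> \<in> (\<lambda>I. exponent_vec (label a I)) ` scarf_faces r a CARD('n)" by blast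
qed (use scarf_facet_outer_corner in blast)

section \<open>The product of the differentiated Scarf maps\<close>

lemma monomial_add: "monomial A (\<lambda>l. b l + c l) = monomial A b * monomial A c"
  by (simp add: monomial_def power_add prod.distrib)

text \<open>What the argument takes from either ring. Integer scalars are enough because the
  coefficients are integers; \<open>pdiff_monomial\<close> carries the sign so that it applies
  directly to entries of the Scarf maps, and the truncated \<open>e l - 1\<close> at
  \<open>e l = 0\<close> is multiplied by 0.\<close>

locale coord_ring_laws =
  fixes A :: "('n::{finite,linorder}, 'a::comm_ring_1) coord_ring"
  assumes scalar_of_int: "scalar A (of_int k) = of_int k"
    and pdiff_zero: "pdiff A l 0 = 0"
    and pdiff_monomial: "pdiff A l ((- 1) ^ m * monomial A e) =
      (- 1) ^ m * of_nat (e l) * monomial A (e(l := e l - 1))"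
    and monomial_mem_ideal_iff: "monomial A b \<in> ideal_gen (monomial A ` B) \<longleftrightarrow> (\<exists>c\<in>B. c \<le> b)"

lemma scarf_map_facet:
  assumes I: "finite I" "card I = k" and i: "i \<in> I"
  shows "scarf_map A a k (I - {i}) I =
    (- 1) ^ card {x \<in> I. x < i} * monomial A (\<lambda>l. label a I l - label a (I - {i}) l)"
proof -
  obtain p where p: "p \<in> {1..k}" "i = nth_elem I p"
    using nth_elem_image[OF I(1)] I(2) i by blast
  let ?t = "\<lambda>j. if I - {i} = I - {nth_elem I j}
    then (-1) ^ (j - 1) * monomial A (\<lambda>l. label a I l - label a (I - {i}) l) else 0"
  have "?t j = 0" if j: "j \<in> {1..k}" "j \<noteq> p" for j
  proof -
    have "nth_elem I j \<noteq> i"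
      using strict_sorted_nth_elem[OF I(1), of j p] strict_sorted_nth_elem[OF I(1), of p j] j p I(2)
      by (cases j p rule: linorder_cases) auto
    then show ?thesis using i by auto
  qed
  then have "scarf_map A a k (I - {i}) I = (\<Sum>j\<in>{p}. ?t j)"
    unfolding scarf_map_def using p(1) by (intro sum.mono_neutral_right) auto
  moreover have "card {x \<in> I. x < i} = p - 1"
    using nth_elem_card_less[OF I(1), of p] p I(2) by auto
  ultimately show ?thesis using p(2) by simp
qed

lemma scarf_map_non_facet:
  assumes I: "finite I" "card I = k" and J: "\<And>i. i \<in> I \<Longrightarrow> J \<noteq> I - {i}"
  shows "scarf_map A a k J I = 0"
  unfolding scarf_map_def
proof (rule sum.neutral, rule ballI)
  fix j assume "j \<in> {1..k}"
  then have "nth_elem I j \<in> I" using nth_elem_image[OF I(1)] I(2) by blast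
  then show "(if J = I - {nth_elem I j} then (- 1) ^ (j - 1) * monomial A (\<lambda>l. label a I l - label a J l)
    else 0) = 0"
    using J by simp
qed

lemma wedge_smult_zero: "wedge \<omega> (form_smult 0 \<theta>) L = 0"
  by (simp add: wedge_def form_smult_def)

context coord_ring_laws
begin

context
  fixes \<sigma> :: "'n \<Rightarrow> 'n" and r :: nat and a :: "nat \<Rightarrow> 'n \<Rightarrow> nat" and I :: "nat set" and v :: "'n \<Rightarrow> nat"
  assumes \<sigma>: "\<sigma> permutes UNIV"
    and I: "I \<in> scarf_faces r a CARD('n)"
    and v: "bij_betw v UNIV I" "\<And>l. a (v l) l = label a I l"
      "\<And>l i. i \<in> I \<Longrightarrow> i \<noteq> v l \<Longrightarrow> a i l < label a I l"
begin

private abbreviation "face k \<equiv> v ` \<sigma> ` first_vars k"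

private lemma v_in: "v l \<in> I"
  using v(1) by (auto simp: bij_betw_def)

private lemma v_eq: "v i = v j \<longleftrightarrow> i = j"
  using v(1) by (auto simp: bij_betw_def dest: injD)

private lemma \<sigma>_eq: "\<sigma> i = \<sigma> j \<longleftrightarrow> i = j"
  using permutes_inj[OF \<sigma>] by (auto dest: injD)

private lemma mem_face: "v (\<sigma> i) \<in> face k \<longleftrightarrow> i \<in> first_vars k"
  by (auto simp: v_eq \<sigma>_eq)

private lemma mem_\<sigma>_image: "\<sigma> i \<in> \<sigma> ` P \<longleftrightarrow> i \<in> P"
  by (auto simp: \<sigma>_eq)

private lemma finite_I: "finite I"
  using bij_betw_finite[OF v(1)] by simp

private lemma var_notin: "k < CARD('n) \<Longrightarrow> var (Suc k) \<notin> (first_vars k :: 'n set)"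
  using first_vars_less by blast

private lemma face_Suc: "face (Suc k) = insert (v (\<sigma> (var (Suc k)))) (face k)"
  unfolding first_vars_Suc by simp

private lemma new_vertex: "k < CARD('n) \<Longrightarrow> v (\<sigma> (var (Suc k))) \<notin> face k"
  using var_notin by (simp add: mem_face)

private lemma card_face: "k \<le> CARD('n) \<Longrightarrow> card (face k) = k"
proof (induction k)
  case (Suc k)
  then show ?case unfolding face_Suc using new_vertex[of k] by (simp add: card_insert_disjoint)
qed (simp add: first_vars_0)

private lemma face_subset: "face k \<subseteq> I"
  by (auto simp: v_in)

private lemma face_mem: "k \<le> CARD('n) \<Longrightarrow> face k \<in> scarf_faces r a k"
  using scarf_complex_subset[OF _ face_subset, of r a k] I by (simp add: scarf_faces_def card_face)

private lemma label_face:
  assumes "v l \<in> J" "J \<subseteq> I"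
  shows "label a J l = label a I l"
proof (rule antisym)
  show "label a J l \<le> label a I l" using finite_I assms(2) by (rule label_mono)
  show "label a I l \<le> label a J l"
    using label_ge[of J "v l" a l] assms finite_subset[OF assms(2) finite_I] v(2) by simp
qed

private lemma label_pos: "0 < label a I l"
  using scarf_facet_outer_corner[OF I] by (simp add: outer_corners_def stair_def exponent_vec_def)

private lemma label_face_less:
  assumes "v l \<notin> J" "J \<subseteq> I"
  shows "label a J l < label a I l"
  using finite_subset[OF assms(2) finite_I] assms v(3)[of _ l] label_pos[of l] by (auto simp: label_less_iff)

text \<open>Removing any vertex other than \<open>v (\<sigma> k)\<close> leaves the label in the variable \<open>\<sigma> k\<close> unchanged.\<close>

private lemma pdiff_other_facet:
  assumes k: "k < CARD('n)" and J: "J \<noteq> face k"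
  shows "pdiff A (\<sigma> (var (Suc k))) (scarf_map A a (Suc k) J (face (Suc k))) = 0"
proof (cases "\<exists>i\<in>face (Suc k). J = face (Suc k) - {i}")
  case True
  let ?s = "\<sigma> (var (Suc k))"
  obtain i where i: "i \<in> face (Suc k)" "J = face (Suc k) - {i}" using True by blast
  have "face (Suc k) - {v ?s} = face k"
    using new_vertex[OF k] unfolding face_Suc by blast
  then have "i \<noteq> v ?s" using i(2) J by blast
  moreover have s: "v ?s \<in> face (Suc k)" unfolding face_Suc by (rule insertI1)
  ultimately have "v ?s \<in> J" using i(2) by blast
  moreover have "J \<subseteq> I" unfolding i(2) using face_subset by (rule order.trans[OF Diff_subset])
  ultimately have "label a J ?s = label a I ?s" by (rule label_face)
  moreover have "label a (face (Suc k)) ?s = label a I ?s"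
    using s face_subset by (rule label_face)
  moreover have "scarf_map A a (Suc k) J (face (Suc k)) = (- 1) ^ card {x \<in> face (Suc k). x < i} *
      monomial A (\<lambda>l. label a (face (Suc k)) l - label a J l)"
    unfolding i(2) using k i(1) finite_subset[OF face_subset finite_I]
    by (intro scarf_map_facet card_face) simp_all
  ultimately show ?thesis by (simp only: pdiff_monomial diff_self_eq_0 of_nat_0 mult_zero_left mult_zero_right)
next
  case False
  then have "scarf_map A a (Suc k) J (face (Suc k)) = 0"
    using k finite_subset[OF face_subset finite_I] by (intro scarf_map_non_facet card_face) (simp, simp, blast)
  then show ?thesis by (simp add: pdiff_zero)
qed

private definition edge :: "'n \<Rightarrow> nat" where
  "edge i = label a I (\<sigma> i) - label a (v ` \<sigma> ` {..<i}) (\<sigma> i)"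

text \<open>The derivative is multiplied by the monomial carried over from the smaller face, so that
  exponents telescope: label differences add up to the new label, and each differentiation takes one
  power from its own variable only.\<close>

private lemma pdiff_face:
  assumes k: "k < CARD('n)"
  shows "pdiff A (\<sigma> (var (Suc k))) (scarf_map A a (Suc k) (face k) (face (Suc k))) *
      monomial A (\<lambda>l. label a (face k) l - (if l \<in> \<sigma> ` first_vars k then 1 else 0)) =
    (- 1) ^ card {i \<in> first_vars k. v (\<sigma> i) < v (\<sigma> (var (Suc k)))} * of_nat (edge (var (Suc k))) *
      monomial A (\<lambda>l. label a (face (Suc k)) l - (if l \<in> \<sigma> ` first_vars (Suc k) then 1 else 0))"
proof -
  let ?x = "var (Suc k) :: 'n"
  let ?s = "\<sigma> ?x"
  let ?e = "\<lambda>l. label a (face (Suc k)) l - label a (face k) l"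
  have "face (Suc k) - {v ?s} = face k"
    using new_vertex[OF k] unfolding face_Suc by blast
  then have "scarf_map A a (Suc k) (face k) (face (Suc k)) =
      (- 1) ^ card {y \<in> face (Suc k). y < v ?s} * monomial A ?e"
    using scarf_map_facet[of "face (Suc k)" "Suc k" "v ?s" A a] k card_face[of "Suc k"]
    by (simp add: face_Suc)
  moreover have "{y \<in> face (Suc k). y < v ?s} = (v \<circ> \<sigma>) ` {i \<in> first_vars k. v (\<sigma> i) < v ?s}"
    unfolding face_Suc by auto
  then have "card {y \<in> face (Suc k). y < v ?s} = card {i \<in> first_vars k. v (\<sigma> i) < v ?s}"
    by (simp add: card_image inj_on_def v_eq \<sigma>_eq)
  moreover have "?e ?s = edge ?x"
  proof -
    have "label a (face (Suc k)) ?s = label a I ?s"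
      by (intro label_face face_subset) (simp add: face_Suc)
    moreover have "first_vars k = {..<?x}"
      using first_vars_eq_less[OF k] by auto
    ultimately show ?thesis by (simp add: edge_def)
  qed
  moreover have "monomial A (?e(?s := ?e ?s - 1)) *
      monomial A (\<lambda>l. label a (face k) l - (if l \<in> \<sigma> ` first_vars k then 1 else 0)) =
      monomial A (\<lambda>l. label a (face (Suc k)) l - (if l \<in> \<sigma> ` first_vars (Suc k) then 1 else 0))"
    unfolding monomial_add[symmetric]
  proof (rule arg_cong[of _ _ "monomial A"], rule ext)
    fix l
    have le: "label a (face k) l \<le> label a (face (Suc k)) l"
      by (rule label_mono) (auto simp: face_Suc)
    have new: "?s \<notin> \<sigma> ` first_vars k" using var_notin[OF k] by (simp add: mem_\<sigma>_image)
    show "(?e(?s := ?e ?s - 1)) l + (label a (face k) l - (if l \<in> \<sigma> ` first_vars k then 1 else 0)) =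
      label a (face (Suc k)) l - (if l \<in> \<sigma> ` first_vars (Suc k) then 1 else 0)"
    proof (cases "l = ?s")
      case True
      have "label a (face (Suc k)) ?s = label a I ?s"
        by (intro label_face face_subset) (simp add: face_Suc)
      \<comment> \<open>The jump is at least 1, so lowering it by 1 is an exact subtraction.\<close>
      moreover have "label a (face k) ?s < label a I ?s"
        by (intro label_face_less face_subset new_vertex k)
      moreover have "?s \<in> \<sigma> ` first_vars (Suc k)" by (simp add: first_vars_Suc)
      ultimately show ?thesis using True new by (simp only: fun_upd_same if_True if_False)
    next
      case False
      then have iff: "l \<in> \<sigma> ` first_vars (Suc k) \<longleftrightarrow> l \<in> \<sigma> ` first_vars k"
        unfolding first_vars_Suc by blast
      have "label a (face k) l = label a I l" if "l \<in> \<sigma> ` first_vars k"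
        using that by (intro label_face face_subset) (auto simp: mem_\<sigma>_image)
      then have "0 < label a (face k) l" if "l \<in> \<sigma> ` first_vars k"
        using that label_pos[of l] by simp
      then show ?thesis
        unfolding iff fun_upd_other[OF False] using le by (cases "l \<in> \<sigma> ` first_vars k") auto
    qed
  qed
  ultimately show ?thesis by (simp only: pdiff_monomial mult.assoc)
qed

text \<open>Induction along the surviving chain. The first power counts, for each new vertex, the
  earlier vertices below it; the second counts the earlier differentials that the new one has to
  pass. In the monomial, every variable already differentiated has lost one power.\<close>

private lemma scarf_dprod_face:
  assumes "k \<le> CARD('n)"
  shows "scarf_dprod A \<sigma> r a k {} (face k) = (\<lambda>L. if L = \<sigma> ` first_vars k then
      (- 1) ^ card {(i, j). i \<in> first_vars k \<and> j \<in> first_vars k \<and> i < j \<and> v (\<sigma> i) < v (\<sigma> j)} *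
      (- 1) ^ card {(i, j). i \<in> first_vars k \<and> j \<in> first_vars k \<and> i < j \<and> \<sigma> j < \<sigma> i} *
      of_nat (\<Prod>i\<in>first_vars k. edge i) *
      monomial A (\<lambda>l. label a (face k) l - (if l \<in> \<sigma> ` first_vars k then 1 else 0)) else 0)"
  using assms
proof (induction k)
  case 0
  have "monomial A (label a {}) = 1" by (simp add: monomial_def label_def)
  moreover have "form_one = (\<lambda>L :: 'n set. if L = {} then 1 else (0 :: 'a))"
    by (rule ext) (simp add: form_one_def)
  ultimately show ?case by (simp add: first_vars_0 cong: if_cong)
next
  case (Suc k)
  then have k: "k < CARD('n)" by simp
  let ?x = "var (Suc k) :: 'n" and ?P = "first_vars k :: 'n set"
  let ?c = "\<lambda>J. pdiff A (\<sigma> ?x) (scarf_map A a (Suc k) J (face (Suc k)))"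
  let ?\<omega> = "scarf_dprod A \<sigma> r a k {} (face k)"
  note IH = Suc.IH[OF less_imp_le[OF k]]
  have less: "i < ?x" if "i \<in> ?P" for i using first_vars_less[OF k that] .
  have not_less: "\<not> ?x < j" if "j \<in> ?P" for j using less[OF that] by (meson order.asym)
  have fin: "finite (scarf_faces r a k)"
    by (rule finite_subset[of _ "Pow {1..r}"]) (auto simp: scarf_faces_def scarf_complex_def)
  have sum: "scarf_dprod A \<sigma> r a (Suc k) {} (face (Suc k)) L =
      wedge ?\<omega> (form_smult (?c (face k)) (form_d (\<sigma> ?x))) L" for L
  proof -
    have "scarf_dprod A \<sigma> r a (Suc k) {} (face (Suc k)) L =
        (\<Sum>K\<in>{face k}. wedge (scarf_dprod A \<sigma> r a k {} K) (form_smult (?c K) (form_d (\<sigma> ?x))) L)"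
      unfolding scarf_dprod.simps(2)
    proof (rule sum.mono_neutral_right[OF fin])
      show "{face k} \<subseteq> scarf_faces r a k"
        using face_mem[OF less_imp_le[OF k]] by (rule insert_subsetI) (rule empty_subsetI)
      show "\<forall>K\<in>scarf_faces r a k - {face k}.
          wedge (scarf_dprod A \<sigma> r a k {} K) (form_smult (?c K) (form_d (\<sigma> ?x))) L = 0"
      proof
        fix K assume "K \<in> scarf_faces r a k - {face k}"
        then have K: "K \<noteq> face k" by blast
        show "wedge (scarf_dprod A \<sigma> r a k {} K) (form_smult (?c K) (form_d (\<sigma> ?x))) L = 0"
          unfolding pdiff_other_facet[OF k K] by (rule wedge_smult_zero)
      qed
    qed
    then show ?thesis by (simp del: scarf_dprod.simps)
  qed
  have step: "scarf_dprod A \<sigma> r a (Suc k) {} (face (Suc k)) = (\<lambda>L. if L = \<sigma> ` first_vars (Suc k) then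
      (- 1) ^ card {i \<in> ?P. \<sigma> ?x < \<sigma> i} * ?c (face k) * ?\<omega> (\<sigma> ` ?P) else 0)"
  proof
    fix L
    have new: "\<sigma> ?x \<notin> \<sigma> ` ?P" using var_notin[OF k] by (simp add: mem_\<sigma>_image)
    have vars: "\<sigma> ` first_vars (Suc k) = insert (\<sigma> ?x) (\<sigma> ` ?P)" unfolding first_vars_Suc by simp
    have zero: "?\<omega> K = 0" if "K \<noteq> \<sigma> ` ?P" for K
      unfolding IH using that by (simp only: if_False)
    have wedge: "wedge ?\<omega> (form_smult (?c (face k)) (form_d (\<sigma> ?x))) L =
        (if L = insert (\<sigma> ?x) (\<sigma> ` ?P) then
          (- 1) ^ card {i \<in> \<sigma> ` ?P. \<sigma> ?x < i} * ?c (face k) * ?\<omega> (\<sigma> ` ?P) else 0)"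
      by (rule wedge_form_d_right[OF _ new]) (erule zero)
    have "{i \<in> \<sigma> ` ?P. \<sigma> ?x < i} = \<sigma> ` {i \<in> ?P. \<sigma> ?x < \<sigma> i}" by auto
    then have "card {i \<in> \<sigma> ` ?P. \<sigma> ?x < i} = card {i \<in> ?P. \<sigma> ?x < \<sigma> i}"
      by (simp add: card_image inj_on_def v_eq \<sigma>_eq)
    then show "scarf_dprod A \<sigma> r a (Suc k) {} (face (Suc k)) L = (if L = \<sigma> ` first_vars (Suc k) then
      (- 1) ^ card {i \<in> ?P. \<sigma> ?x < \<sigma> i} * ?c (face k) * ?\<omega> (\<sigma> ` ?P) else 0)"
      using wedge
      unfolding sum vars[symmetric] by (simp only:)
  qed
  \<comment> \<open>The new variable is the largest so far, so the new pairs are those with it in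
    second place.\<close>
  have pairs: "card {(i, j). i \<in> first_vars (Suc k) \<and> j \<in> first_vars (Suc k) \<and> i < j \<and> R i j} =
      card {(i, j). i \<in> ?P \<and> j \<in> ?P \<and> i < j \<and> R i j} + card {i \<in> ?P. R i ?x}" for R
  proof -
    have "{i \<in> ?P. i < ?x \<and> R i ?x} = {i \<in> ?P. R i ?x}" "{j \<in> ?P. ?x < j \<and> R ?x j} = {}"
      using less not_less by blast+
    then show ?thesis
      unfolding first_vars_Suc card_pairs_insert[OF finite var_notin[OF k], of R] by (simp only: card.empty add_0_right)
  qed
  have edges: "(\<Prod>i\<in>first_vars (Suc k). edge i) = edge ?x * (\<Prod>i\<in>?P. edge i)"
    unfolding first_vars_Suc by (rule prod.insert[OF finite var_notin[OF k]])
  have \<omega>: "?\<omega> (\<sigma> ` ?P) =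
      (- 1) ^ card {(i, j). i \<in> ?P \<and> j \<in> ?P \<and> i < j \<and> v (\<sigma> i) < v (\<sigma> j)} *
      (- 1) ^ card {(i, j). i \<in> ?P \<and> j \<in> ?P \<and> i < j \<and> \<sigma> j < \<sigma> i} *
      of_nat (\<Prod>i\<in>?P. edge i) *
      monomial A (\<lambda>l. label a (face k) l - (if l \<in> \<sigma> ` ?P then 1 else 0))"
    unfolding IH by (simp only: if_True refl)
  have "c * (x * y * z * m) = (c * m) * (x * y * z)" for c x y z m :: 'a
    by (simp only: ac_simps)
  then have "?c (face k) * ?\<omega> (\<sigma> ` ?P) =
      (?c (face k) * monomial A (\<lambda>l. label a (face k) l - (if l \<in> \<sigma> ` ?P then 1 else 0))) *
      ((- 1) ^ card {(i, j). i \<in> ?P \<and> j \<in> ?P \<and> i < j \<and> v (\<sigma> i) < v (\<sigma> j)} *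
      (- 1) ^ card {(i, j). i \<in> ?P \<and> j \<in> ?P \<and> i < j \<and> \<sigma> j < \<sigma> i} *
      of_nat (\<Prod>i\<in>?P. edge i))"
    unfolding \<omega> .
  moreover have "p * ((q * e * m) * (x * y * z)) = (x * q) * (y * p) * (e * z) * m"
    for p q e m x y z :: 'a
    by (simp only: ac_simps)
  ultimately have "(- 1) ^ card {i \<in> ?P. \<sigma> ?x < \<sigma> i} * (?c (face k) * ?\<omega> (\<sigma> ` ?P)) =
      ((- 1) ^ card {(i, j). i \<in> ?P \<and> j \<in> ?P \<and> i < j \<and> v (\<sigma> i) < v (\<sigma> j)} *
      (- 1) ^ card {i \<in> ?P. v (\<sigma> i) < v (\<sigma> ?x)}) *
      ((- 1) ^ card {(i, j). i \<in> ?P \<and> j \<in> ?P \<and> i < j \<and> \<sigma> j < \<sigma> i} *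
      (- 1) ^ card {i \<in> ?P. \<sigma> ?x < \<sigma> i}) *
      (of_nat (edge ?x) * of_nat (\<Prod>i\<in>?P. edge i)) *
      monomial A (\<lambda>l. label a (face (Suc k)) l - (if l \<in> \<sigma> ` first_vars (Suc k) then 1 else 0))"
    by (simp only: pdiff_face[OF k])
  then show ?case
    unfolding step pairs edges power_add of_nat_mult mult.assoc[of "(- 1) ^ card {i \<in> ?P. \<sigma> ?x < \<sigma> i}" "?c (face k)"]
    by (simp only:)
qed

text \<open>\<open>\<eta>\<close> is \<open>v\<close> followed by the inverse of the increasing
  enumeration of \<open>I\<close>; each label coordinate is attained by one vertex only, so the
  definite description in \<open>scarf_sign\<close> returns it. Comparisons of vertices become
  comparisons of values of \<open>\<eta>\<close>, to which \<open>sign_noninversions\<close>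
  applies.\<close>

lemma scarf_dform_eq:
  "scarf_dform A \<sigma> r a I = form_smult
    (of_int (scarf_sign a I) * of_nat (\<Prod>i\<in>UNIV. label a I (\<sigma> i) - label a (v ` \<sigma> ` {..<i}) (\<sigma> i)) *
      monomial A (\<lambda>l. label a I l - 1)) dz"
proof -
  let ?idx = "\<lambda>l::'n. nth_elem I (var_index l)"
  have cardI: "card I = CARD('n)" using I by (simp add: scarf_faces_def)
  note idx = nth_elem_var_index[OF finite_I cardI]
  define \<eta> where "\<eta> = the_inv_into UNIV ?idx \<circ> v"
  have bij: "bij \<eta>"
    unfolding \<eta>_def using bij_betw_trans[OF v(1) bij_betw_the_inv_into[OF idx(1)]] .
  then have \<eta>: "\<eta> permutes UNIV" by (rule bij_imp_permutes) simp
  have idx_\<eta>: "?idx (\<eta> l) = v l" for l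
    using f_the_inv_into_f_bij_betw[OF idx(1) v_in] by (simp add: \<eta>_def)
  have sign: "scarf_sign a I = sign \<eta>"
    unfolding scarf_sign_def
  proof (rule arg_cong[of _ _ sign], rule the_equality)
    show "\<eta> permutes UNIV \<and> (\<forall>l. a (?idx (\<eta> l)) l = label a I l)"
      using \<eta> idx_\<eta> v(2) by simp
  next
    fix \<theta> assume \<theta>: "\<theta> permutes UNIV \<and> (\<forall>l. a (?idx (\<theta> l)) l = label a I l)"
    show "\<theta> = \<eta>"
    proof
      fix l
      have "?idx (\<theta> l) \<in> I" using idx(1) by (auto simp: bij_betw_def)
      then have "?idx (\<theta> l) = v l" using v(3)[of "?idx (\<theta> l)" l] \<theta> by (metis less_irrefl)
      then have "?idx (\<theta> l) = ?idx (\<eta> l)" by (simp add: idx_\<eta>)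
      then show "\<theta> l = \<eta> l" using idx(1) by (auto simp: bij_betw_def dest: injD)
    qed
  qed
  have less: "v i < v j \<longleftrightarrow> \<eta> i < \<eta> j" for i j
    using strict_mono_less[OF idx(2), of "\<eta> i" "\<eta> j"] by (simp add: idx_\<eta>)
  have range_\<sigma>: "range \<sigma> = UNIV" using permutes_surj[OF \<sigma>] .
  have range_v: "range v = I" using v(1) by (simp add: bij_betw_def)
  have "(- 1) ^ card {(i, j). i < j \<and> \<eta> (\<sigma> i) < \<eta> (\<sigma> j)} * (- 1) ^ card {(i, j). i < j \<and> \<sigma> j < \<sigma> i} =
      (of_int (sign \<eta>) * (- 1) ^ card {(i, j). i < (j::'n)} :: 'a)"
    using arg_cong[OF sign_noninversions[OF \<eta> \<sigma>], of "of_int :: int \<Rightarrow> 'a"]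
    by (simp add: inversions_def)
  moreover have "scarf_dprod A \<sigma> r a CARD('n) {} I = (\<lambda>L. if L = UNIV then
      (- 1) ^ card {(i, j). i < j \<and> \<eta> (\<sigma> i) < \<eta> (\<sigma> j)} * (- 1) ^ card {(i, j). i < j \<and> \<sigma> j < \<sigma> i} *
      of_nat (\<Prod>i\<in>UNIV. edge i) * monomial A (\<lambda>l. label a I l - 1) else 0)"
    using scarf_dprod_face[OF order.refl] unfolding first_vars_all range_\<sigma> range_v less
    by (simp cong: if_cong)
  ultimately show ?thesis
    unfolding scarf_dform_def dz_eq sign edge_def
    by (intro ext) (simp add: form_smult_def del: of_nat_prod)
qed

end

lemma scarf_dform_eq_volume:
  fixes \<sigma> :: "'n \<Rightarrow> 'n" and a :: "nat \<Rightarrow> 'n \<Rightarrow> nat"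
  assumes \<sigma>: "\<sigma> permutes UNIV" and art: "artinian r a" and gen: "generic r a"
    and M: "minimal_generators A M r a"
  defines "S \<equiv> staircase A M"
  shows "bij_betw (\<lambda>I. exponent_vec (label a I)) (scarf_faces r a CARD('n)) (outer_corners S)"
    and "I \<in> scarf_faces r a CARD('n) \<Longrightarrow> scarf_dform A \<sigma> r a I =
      form_smult
        (scalar A (of_real (of_int (scarf_sign a I) *
           measure lebesgue (staircase_part \<sigma> S (exponent_vec (label a I))))) *
         monomial A (\<lambda>l. label a I l - 1))
        dz"
proof -
  have "monomial A b \<in> M \<longleftrightarrow> (\<exists>k\<in>{1..r}. a k \<le> b)" for b
    using M monomial_mem_ideal_iff[of b "a ` {1..r}"]
    by (auto simp: minimal_generators_def image_image)
  then have S: "S = stair r a" unfolding S_def by (rule staircase_eq_stair)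
  show "bij_betw (\<lambda>I. exponent_vec (label a I)) (scarf_faces r a CARD('n)) (outer_corners S)"
    unfolding S by (rule bij_betw_scarf_facets[OF gen])
  assume I: "I \<in> scarf_faces r a CARD('n)"
  obtain v where v: "bij_betw v UNIV I" "\<And>l. a (v l) l = label a I l"
    "\<And>l i. i \<in> I \<Longrightarrow> i \<noteq> v l \<Longrightarrow> a i l < label a I l"
    using scarf_facet_vertices[OF I] by metis
  let ?V = "\<Prod>i\<in>UNIV. label a I (\<sigma> i) - label a (v ` \<sigma> ` {..<i}) (\<sigma> i)"
  have vI: "v l \<in> I" for l using v(1) by (auto simp: bij_betw_def)
  have "measure lebesgue (staircase_part \<sigma> S (exponent_vec (label a I))) = real ?V"
    unfolding S
  proof (rule measure_staircase_part[OF \<sigma> art gen scarf_facet_outer_corner[OF I]])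
    show "v l \<in> {1..r}" for l using vI[of l] I by (auto simp: scarf_faces_def scarf_complex_def)
    show "a (v l) l = label a I l" for l by (rule v(2))
    show "a (v l) i < label a I i" if "i \<noteq> l" for l i
      using v(1) that by (intro v(3) vI) (auto simp: bij_betw_def dest: injD)
  qed
  \<comment> \<open>The volume is a natural number, which brings the scalar within reach of
    \<open>scalar_of_int\<close>.\<close>
  then have "complex_of_real (of_int (scarf_sign a I) *
      measure lebesgue (staircase_part \<sigma> S (exponent_vec (label a I)))) =
      of_int (scarf_sign a I * int ?V)" by simp
  then have "scalar A (of_real (of_int (scarf_sign a I) *
      measure lebesgue (staircase_part \<sigma> S (exponent_vec (label a I))))) =
      of_int (scarf_sign a I) * of_nat ?V"
    by (simp only: scalar_of_int) simp
  then show "scarf_dform A \<sigma> r a I =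
      form_smult
        (scalar A (of_real (of_int (scarf_sign a I) *
           measure lebesgue (staircase_part \<sigma> S (exponent_vec (label a I))))) *
         monomial A (\<lambda>l. label a I l - 1))
        dz"
    using scarf_dform_eq[OF \<sigma> I v] by simp
qed

end

section \<open>The polynomial ring\<close>

lemma of_int_homomorphism:
  fixes h :: "'b::ring_1 \<Rightarrow> 'c::ring_1"
  assumes one: "h 1 = 1" and add: "\<And>x y. h (x + y) = h x + h y"
  shows "h (of_int k) = of_int k"
proof -
  have zero: "h 0 = 0" using add[of 0 0] by simp
  have minus: "h (- x) = - h x" for x
    using add[of x "- x"] zero by (simp add: eq_neg_iff_add_eq_0 add.commute)
  have nat: "h (of_nat n) = of_nat n" for n
    by (induction n) (simp_all add: zero one add)
  show ?thesis
    by (cases k rule: int_cases2) (simp_all add: nat minus)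
qed

lemma module_times: "module ((*) :: 'a::comm_ring_1 \<Rightarrow> 'a \<Rightarrow> 'a)"
  by unfold_locales (simp_all add: algebra_simps)

lemma monomial_mem_ideal:
  assumes "c \<in> B" "c \<le> b"
  shows "monomial A b \<in> ideal_gen (monomial A ` B)"
proof -
  have "b = (\<lambda>l. (b l - c l) + c l)"
    using assms(2) by (auto simp: le_fun_def)
  then have "monomial A b = monomial A (\<lambda>l. b l - c l) * monomial A c"
    using monomial_add[of A "\<lambda>l. b l - c l" c] by simp
  then show ?thesis
    using module.span_scale[OF module_times] module.span_base[OF module_times] assms(1) by (metis imageI)
qed

definition exponent_map :: "('n::finite \<Rightarrow> nat) \<Rightarrow> 'n \<Rightarrow>\<^sub>0 nat" where
  "exponent_map e = (\<Sum>i\<in>UNIV. Poly_Mapping.single i (e i))"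

lemma lookup_exponent_map [simp]: "Poly_Mapping.lookup (exponent_map e) i = e i"
proof -
  have "Poly_Mapping.lookup (exponent_map e) i = (\<Sum>j\<in>UNIV. if j = i then e i else 0)"
    unfolding exponent_map_def lookup_sum by (intro sum.cong) (auto simp: lookup_single when_def)
  then show ?thesis by simp
qed

lemma monomial_polynomial_ring: "monomial polynomial_ring e = Poly_Mapping.single (exponent_map e) 1"
proof -
  have power: "Poly_Mapping.single (Poly_Mapping.single i 1) 1 ^ k =
      Poly_Mapping.single (Poly_Mapping.single i k) (1 :: complex)" for i :: 'a and k
    by (induction k) (simp_all add: mult_single flip: single_add)
  have "(\<Prod>i\<in>F. Poly_Mapping.single (Poly_Mapping.single i (e i)) (1 :: complex)) =
      Poly_Mapping.single (\<Sum>i\<in>F. Poly_Mapping.single i (e i)) 1" if "finite F" for F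
    using that by induction (simp_all add: mult_single)
  then show ?thesis
    by (simp add: monomial_def polynomial_ring_def power[simplified] exponent_map_def)
qed

lemma const_times_single:
  "Poly_Mapping.single 0 c * Poly_Mapping.single m (d :: 'a::comm_ring_1) = Poly_Mapping.single (m :: 'n \<Rightarrow>\<^sub>0 nat) (c * d)"
  by (simp add: mult_single)

lemma mpoly_pdiff_single:
  "mpoly_pdiff i (Poly_Mapping.single m c) =
    Poly_Mapping.single (m - Poly_Mapping.single i 1) (of_nat (Poly_Mapping.lookup m i) * c)"
  by (cases "c = 0") (simp_all add: mpoly_pdiff_def)

interpretation polynomial_ring: coord_ring_laws "polynomial_ring :: ('n::{finite,linorder}, 'n mpoly) coord_ring"
proof
  have of_int: "Poly_Mapping.single 0 (of_int k) = (of_int k :: 'n mpoly)" for k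
    by (rule of_int_homomorphism) (simp_all add: single_add)
  show "scalar polynomial_ring (of_int k) = (of_int k :: 'n mpoly)" for k
    using of_int by (simp add: polynomial_ring_def)
  show "pdiff polynomial_ring l 0 = (0 :: 'n mpoly)" for l
    by (simp add: polynomial_ring_def mpoly_pdiff_def)
  fix l :: 'n and m :: nat and e b :: "'n \<Rightarrow> nat" and B :: "('n \<Rightarrow> nat) set"
  have sign: "(- 1) ^ m = (Poly_Mapping.single 0 ((- 1) ^ m) :: 'n mpoly)"
    using of_int[of "(- 1) ^ m"] by simp
  have nat: "of_nat (e l) = (Poly_Mapping.single 0 (of_nat (e l)) :: 'n mpoly)"
    using of_int[of "int (e l)"] by simp
  have "exponent_map e - Poly_Mapping.single l 1 = exponent_map (e(l := e l - 1))"
    by (rule poly_mapping_eqI) (simp add: lookup_minus lookup_single when_def)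
  then show "pdiff polynomial_ring l ((- 1) ^ m * monomial polynomial_ring e) =
      (- 1) ^ m * of_nat (e l) * monomial polynomial_ring (e(l := e l - 1))"
    unfolding monomial_polynomial_ring sign nat mult.assoc const_times_single
    by (simp add: polynomial_ring_def mpoly_pdiff_single mult.commute)
  show "monomial polynomial_ring b \<in> ideal_gen (monomial polynomial_ring ` B) \<longleftrightarrow> (\<exists>c\<in>B. c \<le> b)"
  proof
    \<comment> \<open>Strengthened from monomials to all elements of the ideal so that span
      induction applies: sums and multiples preserve that every occurring exponent lies above a
      generator.\<close>
    have "\<forall>m\<in>Poly_Mapping.keys p. \<exists>c\<in>B. c \<le> Poly_Mapping.lookup m"
      if "p \<in> ideal_gen (monomial polynomial_ring ` B)" for p :: "'n mpoly"
      using that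
    proof (induction rule: module.span_induct_alt[OF module_times, consumes 1, case_names base step])
      case base
      show ?case by simp
    next
      case (step q x y)
      then obtain c where c: "c \<in> B" "x = Poly_Mapping.single (exponent_map c) 1"
        by (auto simp: monomial_polynomial_ring)
      show ?case
      proof
        fix m assume "m \<in> Poly_Mapping.keys (q * x + y)"
        then consider "m \<in> Poly_Mapping.keys (q * x)" | "m \<in> Poly_Mapping.keys y"
          using keys_add[of "q * x" y] by blast
        then show "\<exists>c\<in>B. c \<le> Poly_Mapping.lookup m"
        proof cases
          case 1
          then obtain m' where "m = m' + exponent_map c"
            using keys_mult[of q x] by (auto simp: c(2))
          then have "c \<le> Poly_Mapping.lookup m" by (simp add: le_fun_def lookup_add)
          then show ?thesis using c(1) by blast
        qed (use step in blast)
      qed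
    qed
    then show "\<exists>c\<in>B. c \<le> b" if "monomial polynomial_ring b \<in> ideal_gen (monomial polynomial_ring ` B)"
      using that by (fastforce simp: monomial_polynomial_ring le_fun_def)
  qed (blast intro: monomial_mem_ideal)
qed

section \<open>The ring of germs\<close>

lemma germ_rel_self: "germ_rel f f \<longleftrightarrow> holomorphic_near_0 f"
  by (simp add: germ_rel_def)

lemma holomorphic_near_0_cong:
  assumes f: "holomorphic_near_0 f" and eq: "\<forall>\<^sub>F z in nhds 0. f z = g z"
  shows "holomorphic_near_0 g"
proof -
  \<comment> \<open>Differentiability at a nearby point is local there, so agreement near 0 has to
    be turned into agreement near each nearby point.\<close>
  have "\<forall>\<^sub>F z in nhds 0. \<forall>\<^sub>F y in nhds z. f y = g y"
    using eq by (simp add: eventually_eventually)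
  with f show ?thesis
    unfolding holomorphic_near_0_def
  proof eventually_elim
    case (elim z)
    then have "f z = g z" "\<forall>\<^sub>F y in at z. f y = g y"
      by (auto simp: eventually_nhds_conv_at)
    then show ?case
      using elim(1) has_derivative_transform_eventually[of f _ z UNIV g] by (metis iso_tuple_UNIV_I)
  qed
qed

lemma germ_relI:
  assumes "holomorphic_near_0 f" "\<forall>\<^sub>F z in nhds 0. f z = g z"
  shows "germ_rel f g"
  using assms holomorphic_near_0_cong[OF assms] by (simp add: germ_rel_def)

lemma germ_rel_rep_abs:
  assumes "holomorphic_near_0 f"
  shows "germ_rel (rep_hol_germ (abs_hol_germ f)) f"
  using Quotient3_rep_abs[OF Quotient3_hol_germ] assms by (simp add: germ_rel_self)

lemma germ_rel_rep: "germ_rel (rep_hol_germ g) (rep_hol_germ g)"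
  by (rule Quotient3_rep_reflp[OF Quotient3_hol_germ])

lemma abs_rep_germ: "abs_hol_germ (rep_hol_germ g) = g"
  by (rule Quotient3_abs_rep[OF Quotient3_hol_germ])

lemma abs_germ_eqI: "germ_rel f g \<Longrightarrow> abs_hol_germ f = abs_hol_germ g"
  by (rule Quotient3_rel_abs[OF Quotient3_hol_germ])

lemma holomorphic_near_0_power: "holomorphic_near_0 (\<lambda>z::complex^'n::finite. z $ i ^ k)"
  by (induction k) (simp_all add: holomorphic_near_0_const holomorphic_near_0_mult holomorphic_near_0_coord)

lemma holomorphic_near_0_prod:
  "holomorphic_near_0 (\<lambda>z::complex^'n::finite. \<Prod>i\<in>F. z $ i ^ e i)"
  by (induction F rule: infinite_finite_induct)
    (simp_all add: holomorphic_near_0_const holomorphic_near_0_mult holomorphic_near_0_power)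

lemma monomial_germ_ring:
  "monomial germ_ring e = abs_hol_germ (\<lambda>z::complex^'n::finite. \<Prod>i\<in>UNIV. z $ i ^ e i)"
proof -
  have times: "abs_hol_germ f * abs_hol_germ g = abs_hol_germ (\<lambda>z. f z * g z)"
    if "holomorphic_near_0 f" "holomorphic_near_0 g" for f g :: "complex^'n \<Rightarrow> complex"
    using that times_hol_germ.abs_eq[of f g] by (simp add: germ_rel_self)
  have power: "germ_coord i ^ k = abs_hol_germ (\<lambda>z::complex^'n. z $ i ^ k)" for i k
  proof (induction k)
    case 0
    show ?case by (simp add: one_hol_germ_def)
  next
    case (Suc k)
    show ?case
      using Suc times[OF holomorphic_near_0_coord[of i] holomorphic_near_0_power[of i k]]
      by (simp add: germ_coord_def)
  qed
  have "(\<Prod>i\<in>F. germ_coord i ^ e i) = abs_hol_germ (\<lambda>z::complex^'n. \<Prod>i\<in>F. z $ i ^ e i)"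
    if "finite F" for F
    using that
  proof induction
    case empty
    show ?case by (simp add: one_hol_germ_def)
  next
    case (insert i F)
    then show ?case
      using times[OF holomorphic_near_0_power[of i "e i"] holomorphic_near_0_prod[of e F]]
      by (simp add: power)
  qed
  then show ?thesis by (simp add: monomial_def germ_ring_def)
qed

text \<open>\<open>germ_pdiff\<close> differentiates a chosen representative. That one agrees with
  \<open>f\<close> near each point close to 0, hence along a piece of the coordinate line through
  it, so the derivative may be computed from \<open>f\<close>.\<close>

lemma germ_pdiff_abs:
  fixes f h :: "complex^'n::finite \<Rightarrow> complex"
  assumes f: "holomorphic_near_0 f" and h: "holomorphic_near_0 h"
    and deriv: "\<And>z. deriv (\<lambda>w. f (\<chi> j. if j = l then w else z $ j)) (z $ l) = h z"
  shows "germ_pdiff l (abs_hol_germ f) = abs_hol_germ h"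
proof -
  let ?g = "rep_hol_germ (abs_hol_germ f)"
  have "\<forall>\<^sub>F z in nhds 0. ?g z = f z"
    using germ_rel_rep_abs[OF f] by (simp add: germ_rel_def)
  then have "\<forall>\<^sub>F z in nhds 0. \<forall>\<^sub>F y in nhds z. ?g y = f y"
    by (simp add: eventually_eventually)
  then have "\<forall>\<^sub>F z in nhds 0. h z = deriv (\<lambda>w. ?g (\<chi> j. if j = l then w else z $ j)) (z $ l)"
  proof eventually_elim
    case (elim z)
    have "((\<lambda>w. \<chi> j. if j = l then w else z $ j) \<longlongrightarrow> (\<chi> j. if j = l then z $ l else z $ j)) (nhds (z $ l))"
      by (intro vec_tendstoI) (auto intro: filterlim_ident)
    moreover have "(\<chi> j. if j = l then z $ l else z $ j) = z" by (simp add: vec_eq_iff)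
    ultimately have "filterlim (\<lambda>w. \<chi> j. if j = l then w else z $ j) (nhds z) (nhds (z $ l))"
      by simp
    with elim have "\<forall>\<^sub>F w in nhds (z $ l). ?g (\<chi> j. if j = l then w else z $ j) =
        f (\<chi> j. if j = l then w else z $ j)"
      by (rule eventually_compose_filterlim)
    then have "deriv (\<lambda>w. ?g (\<chi> j. if j = l then w else z $ j)) (z $ l) =
        deriv (\<lambda>w. f (\<chi> j. if j = l then w else z $ j)) (z $ l)"
      by (rule deriv_cong_ev) simp
    then show ?case by (simp add: deriv)
  qed
  then show ?thesis
    unfolding germ_pdiff_def by (intro abs_germ_eqI[symmetric] germ_relI h)
qed

section \<open>Taylor remainders and averages over roots of unity\<close>

lemma holomorphic_taylor_bound:
  fixes h :: "complex \<Rightarrow> complex"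
  assumes "0 < R" and hol: "h holomorphic_on ball 0 R" and bound: "\<And>w. w \<in> ball 0 R \<Longrightarrow> norm (h w) \<le> B"
  shows "\<exists>c. \<forall>w. norm w \<le> R / 4 \<longrightarrow> norm (h w - (\<Sum>i<p. c i * w ^ i)) \<le> 2 * B * (2 / R) ^ p * norm w ^ p"
proof (intro exI allI impI)
  let ?c = "\<lambda>n. (deriv ^^ n) h 0 / fact n"
  have B: "0 \<le> B" using order.trans[OF norm_ge_zero bound[of 0]] \<open>0 < R\<close> by simp
  \<comment> \<open>Cauchy's inequality needs a closed disc inside the ball of holomorphy; the
    radius \<open>R / 2\<close> gives the factor \<open>2 / R\<close>.\<close>
  have coeff: "norm (?c n) \<le> B * (2 / R) ^ n" for n
  proof -
    have "norm ((deriv ^^ n) h 0) \<le> fact n * B / (R / 2) ^ n"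
    proof (rule Cauchy_inequality)
      show "h holomorphic_on ball 0 (R / 2)"
        using hol by (rule holomorphic_on_subset) (use \<open>0 < R\<close> in auto)
      show "continuous_on (cball 0 (R / 2)) h"
        using holomorphic_on_imp_continuous_on[OF hol]
        by (rule continuous_on_subset) (use \<open>0 < R\<close> in auto)
      show "norm (h x) \<le> B" if "norm (0 - x) = R / 2" for x
        using that \<open>0 < R\<close> by (intro bound) simp
    qed (use \<open>0 < R\<close> in auto)
    then have "norm ((deriv ^^ n) h 0) / fact n \<le> (fact n * B / (R / 2) ^ n) / fact n"
      by (rule divide_right_mono) simp
    also have "\<dots> = B * (2 / R) ^ n" by (simp add: power_divide)
    finally show ?thesis by (simp add: norm_divide)
  qed
  fix w :: complex assume w: "norm w \<le> R / 4"
  have "(\<lambda>n. ?c n * w ^ n) sums h w"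
    using holomorphic_power_series[OF hol, of w] w \<open>0 < R\<close> by simp
  then have "(\<lambda>n. ?c (n + p) * w ^ (n + p)) sums (h w - (\<Sum>i<p. ?c i * w ^ i))"
    by (rule sums_split_initial_segment)
  \<comment> \<open>For \<open>norm w \<le> R / 4\<close> the ratio \<open>2 / R * norm w\<close> is
    at most \<open>1 / 2\<close>, and the geometric tail sums to the factor 2.\<close>
  moreover have le: "norm (?c (n + p) * w ^ (n + p)) \<le> B * (2 / R) ^ p * norm w ^ p * (1 / 2) ^ n" for n
  proof -
    have "norm (?c (n + p) * w ^ (n + p)) \<le> (B * (2 / R) ^ (n + p)) * norm w ^ (n + p)"
      unfolding norm_mult norm_power using coeff[of "n + p"] by (rule mult_right_mono) simp
    also have "\<dots> = B * (2 / R) ^ p * norm w ^ p * (2 / R * norm w) ^ n"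
      unfolding power_add power_mult_distrib[of "2 / R" "norm w"] by (simp only: ac_simps)
    also have "\<dots> \<le> B * (2 / R) ^ p * norm w ^ p * (1 / 2) ^ n"
      using B w \<open>0 < R\<close> by (intro mult_left_mono power_mono) (auto simp: field_simps)
    finally show ?thesis .
  qed
  moreover have geo: "(\<lambda>n. B * (2 / R) ^ p * norm w ^ p * (1 / 2) ^ n) sums (B * (2 / R) ^ p * norm w ^ p * 2)"
    using geometric_sums[of "1 / 2 :: real"] by (intro sums_mult) simp
  ultimately have "norm (h w - (\<Sum>i<p. ?c i * w ^ i)) \<le> B * (2 / R) ^ p * norm w ^ p * 2"
    by (metis (no_types, lifting) norm_suminf_le sums_unique sums_summable)
  then show "norm (h w - (\<Sum>i<p. ?c i * w ^ i)) \<le> 2 * B * (2 / R) ^ p * norm w ^ p"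
    by (simp add: mult_ac)
qed

definition unit_root :: "nat \<Rightarrow> complex" where
  "unit_root N = exp (2 * of_real pi * \<i> / of_nat N)"

lemma norm_unit_root [simp]: "norm (unit_root N) = 1"
  by (simp add: unit_root_def)

lemma unit_root_nonzero [simp]: "unit_root N \<noteq> 0"
  by (simp add: unit_root_def)

lemma sum_powers_unit_root:
  assumes "0 < q" "q < N"
  shows "(\<Sum>m<N. (unit_root N ^ q) ^ m) = 0"
proof -
  have *: "unit_root N ^ q = exp (2 * of_real pi * \<i> * of_nat q / of_nat N)" for q
    unfolding unit_root_def by (simp flip: exp_of_nat_mult add: mult_ac)
  have "\<not> N dvd q" using assms by (meson nat_dvd_not_less)
  then have "unit_root N ^ q \<noteq> 1"
    unfolding * using assms by (subst complex_root_unity_eq_1) auto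
  moreover have "unit_root N ^ N = 1"
    unfolding * using assms by (subst complex_root_unity_eq_1) auto
  then have "(unit_root N ^ q) ^ N = 1"
    by (metis mult.commute power_mult power_one)
  ultimately show ?thesis by (simp add: geometric_sum)
qed

text \<open>The average annihilates the Taylor polynomial of degree below \<open>N - d\<close>,
  since for its terms the exponents \<open>d + i\<close> lie strictly between 0 and
  \<open>N\<close>. Only the remainder of order \<open>N - d\<close> survives.\<close>

lemma unit_root_average_bound:
  fixes h :: "complex \<Rightarrow> complex"
  assumes R: "0 < R" and hol: "h holomorphic_on ball 0 R"
    and bound: "\<And>w. w \<in> ball 0 R \<Longrightarrow> norm (h w) \<le> B"
    and d: "0 < d" and \<rho>: "0 \<le> \<rho>" "\<rho> \<le> R / 4"
  shows "norm (\<Sum>m<N. unit_root N ^ (m * d) * h (of_real \<rho> * unit_root N ^ m))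
    \<le> real N * (2 * B * (2 / R) ^ (N - d)) * \<rho> ^ (N - d)"
proof -
  let ?z = "unit_root N" and ?p = "N - d"
  obtain c where c: "\<And>w. norm w \<le> R / 4 \<Longrightarrow>
      norm (h w - (\<Sum>i<?p. c i * w ^ i)) \<le> 2 * B * (2 / R) ^ ?p * norm w ^ ?p"
    using holomorphic_taylor_bound[OF R hol bound] by blast
  have "(\<Sum>m<N. ?z ^ (m * d) * (\<Sum>i<?p. c i * (of_real \<rho> * ?z ^ m) ^ i)) =
      (\<Sum>i<?p. c i * of_real \<rho> ^ i * (\<Sum>m<N. (?z ^ (d + i)) ^ m))"
    unfolding sum_distrib_left
    by (subst sum.swap) (simp add: power_mult_distrib algebra_simps flip: power_mult power_add)
  also have "\<dots> = 0"
    using d by (intro sum.neutral) (auto simp: sum_powers_unit_root)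
  finally have "(\<Sum>m<N. ?z ^ (m * d) * h (of_real \<rho> * ?z ^ m)) =
      (\<Sum>m<N. ?z ^ (m * d) * (h (of_real \<rho> * ?z ^ m) - (\<Sum>i<?p. c i * (of_real \<rho> * ?z ^ m) ^ i)))"
    by (simp add: right_diff_distrib sum_subtractf)
  also have "norm \<dots> \<le> (\<Sum>m<N. 2 * B * (2 / R) ^ ?p * \<rho> ^ ?p)"
  proof (rule sum_norm_le)
    fix m
    have "norm (of_real \<rho> * ?z ^ m) = \<rho>" using \<rho> by (simp add: norm_mult norm_power)
    then show "norm (?z ^ (m * d) * (h (of_real \<rho> * ?z ^ m) - (\<Sum>i<?p. c i * (of_real \<rho> * ?z ^ m) ^ i)))
        \<le> 2 * B * (2 / R) ^ ?p * \<rho> ^ ?p"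
      using c[of "of_real \<rho> * ?z ^ m"] \<rho> by (simp add: norm_mult norm_power)
  qed
  finally show ?thesis by (simp add: mult_ac)
qed

lemma eventually_nhds_0_polydisc:
  fixes P :: "complex^'n::finite \<Rightarrow> bool"
  assumes "\<forall>\<^sub>F z in nhds 0. P z"
  obtains R where "0 < R" "\<And>z. (\<And>i. norm (z $ i) < R) \<Longrightarrow> P z"
proof -
  obtain \<delta> where \<delta>: "0 < \<delta>" "\<And>z. dist z 0 < \<delta> \<Longrightarrow> P z"
    using assms unfolding eventually_nhds_metric by blast
  \<comment> \<open>The norm is at most the sum of the coordinate norms, so the polydisc of this
    radius lies in the ball.\<close>
  let ?R = "\<delta> / real CARD('n)"
  show thesis
  proof (rule that[of ?R])
    show "0 < ?R" using \<delta>(1) by simp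
    fix z :: "complex^'n" assume z: "\<And>i. norm (z $ i) < ?R"
    have "norm z \<le> (\<Sum>i\<in>UNIV. norm (z $ i))" 
      unfolding norm_vec_def by (rule L2_set_le_sum) simp
    also have "\<dots> < (\<Sum>i\<in>(UNIV :: 'n set). ?R)" using z by (intro sum_strict_mono) auto
    also have "\<dots> = \<delta>" by simp
    finally show "P z" by (intro \<delta>(2)) simp
  qed
qed

text \<open>The torus sums are estimated in one coordinate at a time; joint differentiability yields
  what this takes, a uniform bound and holomorphy along each coordinate line. The bound comes from
  continuity at 0.\<close>

lemma holomorphic_near_0_polydisc:
  fixes g :: "complex^'n::finite \<Rightarrow> complex"
  assumes "holomorphic_near_0 g"
  obtains R B where "0 < R"
    "\<And>z. (\<And>i. norm (z $ i) < R) \<Longrightarrow> norm (g z) \<le> B"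
    "\<And>q l. (\<And>i. norm (q $ i) < R) \<Longrightarrow> (\<lambda>w. g (\<chi> j. if j = l then w else q $ j)) holomorphic_on ball 0 R"
proof -
  let ?P = "\<lambda>z. \<exists>g'. (g has_derivative g') (at z) \<and> (\<forall>c v. g' (c *s v) = c * g' v)"
  have "\<forall>\<^sub>F z in nhds 0. ?P z" using assms by (simp add: holomorphic_near_0_def)
  moreover then have "isCont g 0"
    using eventually_nhds_x_imp_x has_derivative_continuous by blast
  then have "\<forall>\<^sub>F z in at 0. norm (g z) < norm (g 0) + 1"
    by (intro order_tendstoD(2)[OF tendsto_norm[of g "g 0"]]) (auto simp: isCont_def)
  then have "\<forall>\<^sub>F z in nhds 0. norm (g z) < norm (g 0) + 1"
    by (simp add: eventually_nhds_conv_at)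
  ultimately have ev: "\<forall>\<^sub>F z in nhds 0. ?P z \<and> norm (g z) < norm (g 0) + 1"
    by (rule eventually_conj)
  obtain R where R: "0 < R" "\<And>z. (\<And>i. norm (z $ i) < R) \<Longrightarrow> ?P z \<and> norm (g z) < norm (g 0) + 1"
    using eventually_nhds_0_polydisc[OF ev] by blast
  show thesis
  proof (rule that[OF R(1)])
    show "norm (g z) \<le> norm (g 0) + 1" if "\<And>i. norm (z $ i) < R" for z
      using R(2)[OF that] by simp
    fix q :: "complex^'n" and l assume q: "\<And>i. norm (q $ i) < R"
    show "(\<lambda>w. g (\<chi> j. if j = l then w else q $ j)) holomorphic_on ball 0 R"
      unfolding holomorphic_on_def
    proof
      fix w :: complex assume w: "w \<in> ball 0 R"
      define u where "u x = (\<chi> j. if j = l then x else q $ j)" for x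
      have "norm (u w $ i) < R" for i using q w by (simp add: u_def)
      then obtain g' where g': "(g has_derivative g') (at (u w))" "\<And>c v. g' (c *s v) = c * g' v"
        using R(2)[of "u w"] by blast
      have "u = (\<lambda>x. (\<chi> j. if j = l then 0 else q $ j) + axis l x)"
        by (auto simp: u_def axis_def vec_eq_iff)
      moreover have "linear (axis l :: complex \<Rightarrow> complex^'n)"
        by (rule linearI) (auto simp: axis_def vec_eq_iff)
      then have "((\<lambda>x. axis l x :: complex^'n) has_derivative axis l) (at w)"
        by (intro bounded_linear_imp_has_derivative) (simp add: linear_conv_bounded_linear)
      ultimately have "(u has_derivative axis l) (at w)"
        using has_derivative_add[OF has_derivative_const] by fastforce
      then have "((\<lambda>x. g (u x)) has_derivative (\<lambda>x. g' (axis l x))) (at w)"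
        using g'(1) by (rule has_derivative_compose)
      \<comment> \<open>Complex linearity of \<open>g'\<close> turns the real derivative along the
        axis into multiplication by a complex number.\<close>
      moreover have "(\<lambda>x. g' (axis l x)) = (*) (g' (axis l 1))"
      proof
        fix x
        have "axis l x = x *s (axis l 1 :: complex^'n)" by (simp add: axis_def vec_eq_iff)
        then show "g' (axis l x) = g' (axis l 1) * x"
          using g'(2)[of x "axis l 1"] by (simp only: mult.commute)
      qed
      ultimately have "((\<lambda>x. g (u x)) has_field_derivative g' (axis l 1)) (at w)"
        by (simp only: has_field_derivative_def)
      then show "(\<lambda>w. g (\<chi> j. if j = l then w else q $ j)) field_differentiable at w within ball 0 R"
        unfolding u_def field_differentiable_def by (blast intro: has_field_derivative_at_within)
    qed
  qed
qed

text \<open>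
  A discrete Cauchy integral over the torus of radius \<open>\<rho>\<close>: averaging over \<open>N\<close>-th roots of unity picks
  out of the Taylor series of \<open>f\<close> the exponents congruent to \<open>b\<close> modulo \<open>N\<close>. For \<open>N > \<Sum>i. b i\<close> the
  monomial with exponent \<open>b\<close> is seen at order \<open>\<Sum>i. b i\<close> in \<open>\<rho>\<close>, whereas multiples of monomials not
  dividing it contribute only \<open>O(\<rho> ^ N)\<close>.
\<close>

definition torus_sum :: "nat \<Rightarrow> ('n::finite \<Rightarrow> nat) \<Rightarrow> (complex^'n \<Rightarrow> complex) \<Rightarrow> real \<Rightarrow> complex" where
  "torus_sum N b f \<rho> = (\<Sum>k\<in>Pi UNIV (\<lambda>_. {..<N}).
     (\<Prod>i\<in>UNIV. inverse (unit_root N) ^ (b i * k i)) * f (\<chi> i. of_real \<rho> * unit_root N ^ k i))"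

text \<open>The constant \<open>C\<close> may depend on \<open>f\<close> and only small \<rho>
  matter, so the property passes to sums and depends on the germ alone.\<close>

definition torus_small :: "nat \<Rightarrow> ('n::finite \<Rightarrow> nat) \<Rightarrow> (complex^'n \<Rightarrow> complex) \<Rightarrow> bool" where
  "torus_small N b f \<longleftrightarrow> (\<exists>C. \<forall>\<^sub>F \<rho> in at_right 0. norm (torus_sum N b f \<rho>) \<le> C * \<rho> ^ N)"

lemma finite_Pi_UNIV: "finite (Pi (UNIV :: 'n::finite set) (\<lambda>_. {..<N::nat}))"
  using finite_PiE[of "UNIV :: 'n set" "\<lambda>_. {..<N}"] by (simp add: PiE_UNIV_domain)

lemma torus_small_cong:
  fixes f g :: "complex^'n::finite \<Rightarrow> complex"
  assumes f: "torus_small N b f" and eq: "\<forall>\<^sub>F z in nhds 0. f z = g z"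
  shows "torus_small N b g"
proof -
  obtain R where R: "0 < R" "\<And>z. (\<And>i. norm (z $ i) < R) \<Longrightarrow> f z = g z"
    using eventually_nhds_0_polydisc[OF eq] by blast
  obtain C where C: "\<forall>\<^sub>F \<rho> in at_right 0. norm (torus_sum N b f \<rho>) \<le> C * \<rho> ^ N"
    using f by (auto simp: torus_small_def)
  have "\<forall>\<^sub>F \<rho> in at_right 0. \<rho> < R" "\<forall>\<^sub>F \<rho> in at_right (0::real). 0 < \<rho>"
    using R(1) by (auto simp: eventually_at_right_less eventually_at_right_field)
  with C have "\<forall>\<^sub>F \<rho> in at_right 0. norm (torus_sum N b g \<rho>) \<le> C * \<rho> ^ N"
  proof eventually_elim
    case (elim \<rho>)
    then have "torus_sum N b f \<rho> = torus_sum N b g \<rho>"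
      unfolding torus_sum_def
      by (intro sum.cong refl arg_cong2[of _ _ _ _ times] R(2)) (simp add: norm_mult norm_power)
    then show ?case using elim by simp
  qed
  then show ?thesis by (auto simp: torus_small_def)
qed

lemma torus_small_germ_rel:
  assumes "germ_rel f g"
  shows "torus_small N b f \<longleftrightarrow> torus_small N b g"
proof -
  have "\<forall>\<^sub>F z in nhds 0. f z = g z" using assms by (simp add: germ_rel_def)
  moreover then have "\<forall>\<^sub>F z in nhds 0. g z = f z" by eventually_elim simp
  ultimately show ?thesis using torus_small_cong by blast
qed

lemma torus_small_zero: "torus_small N b (\<lambda>_. 0)"
  unfolding torus_small_def torus_sum_def by (rule exI[of _ 0]) simp

lemma torus_small_add:
  assumes "torus_small N b f" "torus_small N b g"
  shows "torus_small N b (\<lambda>z. f z + g z)"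
proof -
  obtain C D where "\<forall>\<^sub>F \<rho> in at_right 0. norm (torus_sum N b f \<rho>) \<le> C * \<rho> ^ N"
    "\<forall>\<^sub>F \<rho> in at_right 0. norm (torus_sum N b g \<rho>) \<le> D * \<rho> ^ N"
    using assms by (auto simp: torus_small_def)
  then have "\<forall>\<^sub>F \<rho> in at_right 0. norm (torus_sum N b (\<lambda>z. f z + g z) \<rho>) \<le> (C + D) * \<rho> ^ N"
  proof eventually_elim
    case (elim \<rho>)
    have "torus_sum N b (\<lambda>z. f z + g z) \<rho> = torus_sum N b f \<rho> + torus_sum N b g \<rho>"
      by (simp add: torus_sum_def algebra_simps sum.distrib)
    then show ?case using elim norm_triangle_ineq[of "torus_sum N b f \<rho>" "torus_sum N b g \<rho>"]
      by (simp add: algebra_simps)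
  qed
  then show ?thesis by (auto simp: torus_small_def)
qed

text \<open>Isolates the coordinate \<open>l\<close> of a torus sum, so that the one-variable
  average bound applies to the inner sum.\<close>

lemma sum_Pi_UNIV_split:
  "(\<Sum>k\<in>Pi UNIV (\<lambda>_. {..<N}). F k) =
    (\<Sum>k\<in>{k \<in> Pi (UNIV :: 'n::finite set) (\<lambda>_. {..<N::nat}). k l = 0}. \<Sum>m<N. F (k(l := m)) :: 'b::comm_monoid_add)"
proof -
  let ?T = "Pi (UNIV :: 'n set) (\<lambda>_. {..<N})" and ?U = "{k \<in> Pi (UNIV :: 'n set) (\<lambda>_. {..<N}). k l = 0}"
  have "finite ?U" by (rule finite_subset[OF _ finite_Pi_UNIV[of N]]) blast
  then have "(\<Sum>k\<in>?U. \<Sum>m<N. F (k(l := m))) = (\<Sum>(k, m)\<in>?U \<times> {..<N}. F (k(l := m)))"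
    by (simp add: sum.cartesian_product)
  also have "\<dots> = (\<Sum>k\<in>?T. F k)"
  proof (rule sum.reindex_bij_witness[of _ "\<lambda>k. (k(l := 0), k l)" "\<lambda>(k, m). k(l := m)"])
    fix p assume p: "p \<in> ?U \<times> {..<N}"
    obtain k m where km: "p = (k, m)" by (cases p)
    show "((case p of (k, m) \<Rightarrow> k(l := m))(l := 0), (case p of (k, m) \<Rightarrow> k(l := m)) l) = p"
      using p by (simp add: km fun_upd_idem)
    show "(case p of (k, m) \<Rightarrow> k(l := m)) \<in> ?T"
      using p by (simp add: km Pi_iff)
    show "F (case p of (k, m) \<Rightarrow> k(l := m)) = (case p of (k, m) \<Rightarrow> F (k(l := m)))"
      by (simp add: km)
  next
    fix k assume "k \<in> ?T"
    then show "(k(l := 0), k l) \<in> ?U \<times> {..<N}" "(case (k(l := 0), k l) of (k, m) \<Rightarrow> k(l := m)) = k"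
      by (auto simp: Pi_iff)
  qed
  finally show ?thesis by simp
qed

text \<open>In the coordinate \<open>l\<close> the excess \<open>c l - b l\<close> is positive, so
  the inner sum is an average of order \<open>N - (c l - b l)\<close> in \<rho>. The monomial itself
  supplies \<open>\<rho> ^ c l\<close>, and together the order is at least \<open>N\<close>, also
  when the subtraction is truncated.\<close>

lemma torus_small_multiple:
  fixes g :: "complex^'n::finite \<Rightarrow> complex"
  assumes g: "holomorphic_near_0 g" and l: "b l < c l"
  shows "torus_small N b (\<lambda>z. (\<Prod>i\<in>UNIV. z $ i ^ c i) * g z)"
proof -
  obtain R B where R: "0 < R"
    and bound: "\<And>z. (\<And>i. norm (z $ i) < R) \<Longrightarrow> norm (g z) \<le> B"
    and hol: "\<And>q l. (\<And>i. norm (q $ i) < R) \<Longrightarrow> (\<lambda>w. g (\<chi> j. if j = l then w else q $ j)) holomorphic_on ball 0 R"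
    using holomorphic_near_0_polydisc[OF g] by blast
  let ?z = "unit_root N" and ?d = "c l - b l"
  let ?T0 = "{k \<in> Pi (UNIV :: 'n set) (\<lambda>_. {..<N}). k l = 0}"
  define C where "C = real N * (2 * B * (2 / R) ^ (N - ?d))"
  have "0 \<le> B" using order.trans[OF norm_ge_zero bound[of 0]] R by simp
  then have C: "0 \<le> C" using R by (simp add: C_def)
  \<comment> \<open>\<open>R / 4\<close> is the range of the Taylor estimate; \<rho> below 1 bounds
    the factors of the other coordinates by 1 and makes higher powers smaller.\<close>
  have est: "norm (torus_sum N b (\<lambda>z. (\<Prod>i\<in>UNIV. z $ i ^ c i) * g z) \<rho>) \<le> real (card ?T0) * C * \<rho> ^ N"
    if \<rho>: "0 < \<rho>" "\<rho> < min (R / 4) 1" for \<rho>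
  proof -
    define F where "F k = (\<Prod>i\<in>UNIV. inverse ?z ^ (b i * k i)) *
      ((\<Prod>i\<in>UNIV. (of_real \<rho> * ?z ^ k i) ^ c i) * g (\<chi> i. of_real \<rho> * ?z ^ k i))" for k
    have inner: "norm (\<Sum>m<N. F (k(l := m))) \<le> C * \<rho> ^ N" for k
    proof -
      define a where "a = (\<Prod>i\<in>UNIV - {l}. inverse ?z ^ (b i * k i) * (of_real \<rho> * ?z ^ k i) ^ c i)"
      define h where "h w = g (\<chi> j. if j = l then w else (\<chi> i. of_real \<rho> * ?z ^ k i) $ j)" for w
      have q: "norm ((\<chi> i. of_real \<rho> * ?z ^ k i) $ i) < R" for i
        using \<rho> R by (simp add: norm_mult norm_power)
      have F: "F (k(l := m)) = (a * of_real \<rho> ^ c l) * (?z ^ (m * ?d) * h (of_real \<rho> * ?z ^ m))" for m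
      proof -
        have "(\<Prod>i\<in>UNIV. inverse ?z ^ (b i * (k(l := m)) i) * (of_real \<rho> * ?z ^ (k(l := m)) i) ^ c i) =
            (inverse ?z ^ (b l * m) * (of_real \<rho> * ?z ^ m) ^ c l) * a"
          unfolding a_def by (subst prod.remove[of _ l]) (auto intro!: prod.cong arg_cong2[of _ _ _ _ times])
        moreover have "inverse ?z ^ (b l * m) * (of_real \<rho> * ?z ^ m) ^ c l = of_real \<rho> ^ c l * ?z ^ (m * ?d)"
        proof -
          have "m * c l = b l * m + m * ?d"
            using l by (simp add: diff_mult_distrib2 mult.commute)
          then have "(?z ^ m) ^ c l = ?z ^ (b l * m) * ?z ^ (m * ?d)"
            by (simp flip: power_add power_mult)
          then show ?thesis by (simp add: power_mult_distrib power_inverse)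
        qed
        moreover have "(\<chi> i. of_real \<rho> * ?z ^ (k(l := m)) i) =
            (\<chi> j. if j = l then of_real \<rho> * ?z ^ m else (\<chi> i. of_real \<rho> * ?z ^ k i) $ j)"
          by (simp add: vec_eq_iff)
        ultimately show ?thesis
          unfolding F_def h_def mult.assoc[symmetric] prod.distrib[symmetric] by (simp add: mult_ac)
      qed
      have "norm (\<Sum>m<N. ?z ^ (m * ?d) * h (of_real \<rho> * ?z ^ m)) \<le> C * \<rho> ^ (N - ?d)"
        unfolding C_def
      proof (rule unit_root_average_bound[OF R])
        show "h holomorphic_on ball 0 R" unfolding h_def using q by (rule hol)
        show "norm (h w) \<le> B" if "w \<in> ball 0 R" for w
          unfolding h_def using q that by (intro bound) auto
      qed (use \<rho> l in auto)
      moreover have "norm a \<le> 1"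
        unfolding a_def prod_norm[symmetric] using \<rho>
        by (intro prod_le_1) (auto simp: norm_mult norm_power norm_inverse power_le_one)
      then have "norm (a * of_real \<rho> ^ c l) \<le> \<rho> ^ c l"
        using \<rho> by (simp add: norm_mult norm_power mult_left_le_one_le)
      ultimately have "norm (a * of_real \<rho> ^ c l) * norm (\<Sum>m<N. ?z ^ (m * ?d) * h (of_real \<rho> * ?z ^ m)) \<le>
          \<rho> ^ c l * (C * \<rho> ^ (N - ?d))"
        using \<rho> by (intro mult_mono) auto
      also have "\<dots> = C * \<rho> ^ (c l + (N - ?d))" by (simp add: power_add)
      also have "\<dots> \<le> C * \<rho> ^ N"
      proof (rule mult_left_mono[OF power_decreasing C])
        show "N \<le> c l + (N - ?d)" by linarith
      qed (use \<rho> in auto)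
      finally show ?thesis
        unfolding F sum_distrib_left[symmetric] norm_mult[of "a * of_real \<rho> ^ c l"] .
    qed
    have "torus_sum N b (\<lambda>z. (\<Prod>i\<in>UNIV. z $ i ^ c i) * g z) \<rho> = (\<Sum>k\<in>?T0. \<Sum>m<N. F (k(l := m)))"
      unfolding torus_sum_def by (subst sum_Pi_UNIV_split[of _ N l]) (simp add: F_def)
    also have "norm \<dots> \<le> (\<Sum>k\<in>?T0. C * \<rho> ^ N)"
      by (rule sum_norm_le) (rule inner)
    finally show ?thesis by (simp add: mult.assoc)
  qed
  have "\<forall>\<^sub>F \<rho> in at_right 0. 0 < \<rho> \<and> \<rho> < min (R / 4) 1"
    using R by (auto simp: eventually_at_right_field intro!: exI[of _ "min (R / 4) 1"])
  then have "\<forall>\<^sub>F \<rho> in at_right 0. norm (torus_sum N b (\<lambda>z. (\<Prod>i\<in>UNIV. z $ i ^ c i) * g z) \<rho>)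
      \<le> (real (card ?T0) * C) * \<rho> ^ N"
    by eventually_elim (use est in auto)
  then show ?thesis unfolding torus_small_def by blast
qed

text \<open>All summands equal \<rho> to the total degree of \<open>b\<close>, and \<open>N\<close>
  is one larger. A bound of order \<open>N\<close> would, after division, force the positive number
  of summands below \<open>C * \<rho>\<close>, which tends to 0.\<close>

lemma not_torus_small_monomial:
  fixes b :: "'n::finite \<Rightarrow> nat"
  defines "N \<equiv> Suc (\<Sum>i\<in>UNIV. b i)"
  shows "\<not> torus_small N b (\<lambda>z. \<Prod>i\<in>UNIV. z $ i ^ b i)"
proof
  let ?s = "\<Sum>i\<in>UNIV. b i" and ?T = "Pi (UNIV :: 'n set) (\<lambda>_. {..<N})"
  assume "torus_small N b (\<lambda>z. \<Prod>i\<in>UNIV. z $ i ^ b i)"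
  then obtain C where C: "\<forall>\<^sub>F \<rho> in at_right 0. norm (torus_sum N b (\<lambda>z. \<Prod>i\<in>UNIV. z $ i ^ b i) \<rho>) \<le> C * \<rho> ^ N"
    by (auto simp: torus_small_def)
  have sum: "torus_sum N b (\<lambda>z. \<Prod>i\<in>UNIV. z $ i ^ b i) \<rho> = of_nat (card ?T) * of_real \<rho> ^ ?s" for \<rho>
  proof -
    have "(\<Prod>i\<in>UNIV. inverse (unit_root N) ^ (b i * k i)) * (\<Prod>i\<in>UNIV. (of_real \<rho> * unit_root N ^ k i) ^ b i) =
        of_real \<rho> ^ ?s" for k :: "'n \<Rightarrow> nat"
    proof -
      have "inverse (unit_root N) ^ (b i * k i) * (of_real \<rho> * unit_root N ^ k i) ^ b i = of_real \<rho> ^ b i" for i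
        by (simp add: power_mult_distrib power_inverse mult.commute[of "b i"] flip: power_mult)
      then show ?thesis by (simp add: power_sum flip: prod.distrib)
    qed
    then show ?thesis by (simp add: torus_sum_def)
  qed
  have "0 < card ?T"
  proof -
    have "(\<lambda>_. 0) \<in> ?T" by (simp add: N_def)
    then show ?thesis using finite_Pi_UNIV card_gt_0_iff by blast
  qed
  have "\<forall>\<^sub>F \<rho> in at_right (0::real). 0 < \<rho>" by (simp add: eventually_at_right_less)
  with C have "\<forall>\<^sub>F \<rho> in at_right 0. real (card ?T) \<le> C * \<rho>"
  proof eventually_elim
    case (elim \<rho>)
    then have "real (card ?T) * \<rho> ^ ?s \<le> (C * \<rho>) * \<rho> ^ ?s"
      unfolding sum by (simp add: norm_mult norm_power N_def mult_ac)
    then show ?case using elim(2) by (simp add: mult_le_cancel_right)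
  qed
  moreover have "((\<lambda>\<rho>. C * \<rho>) \<longlongrightarrow> C * 0) (at_right 0)"
    by (intro tendsto_intros)
  ultimately have "real (card ?T) \<le> C * 0"
    by (intro tendsto_lowerbound[of _ _ "at_right 0"]) auto
  then show False using \<open>0 < card ?T\<close> by simp
qed

text \<open>If no generator divides the monomial, every multiple of a generator is torus-small for
  the exponent \<open>b\<close>, hence so is the whole ideal; the monomial with exponent
  \<open>b\<close> is not.\<close>

lemma monomial_mem_germ_ideal:
  assumes mem: "monomial germ_ring b \<in> ideal_gen (monomial germ_ring ` B)"
  shows "\<exists>c\<in>B. c \<le> (b :: 'n::finite \<Rightarrow> nat)"
proof (rule ccontr)
  assume none: "\<not> (\<exists>c\<in>B. c \<le> b)"
  let ?N = "Suc (\<Sum>i\<in>UNIV. b i)"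
  have "torus_small ?N b (rep_hol_germ x)" if "x \<in> ideal_gen (monomial germ_ring ` B)" for x
    using that
  proof (induction rule: module.span_induct_alt[OF module_times, consumes 1, case_names base step])
    case base
    have "germ_rel (rep_hol_germ 0) (\<lambda>_ :: complex^'n. 0)"
      unfolding zero_hol_germ_def by (rule germ_rel_rep_abs) (rule holomorphic_near_0_const)
    then show ?case
      using torus_small_zero torus_small_germ_rel by blast
  next
    case (step q x y)
    then obtain c where c: "c \<in> B" "x = monomial germ_ring c" by blast
    then obtain l where l: "b l < c l" using none by (auto simp: le_fun_def not_le)
    let ?m = "\<lambda>z :: complex^'n. \<Prod>i\<in>UNIV. z $ i ^ c i"
    have q: "holomorphic_near_0 (rep_hol_germ q)" and y: "holomorphic_near_0 (rep_hol_germ y)"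
      using germ_rel_rep by (auto simp: germ_rel_self)
    have m: "holomorphic_near_0 ?m" by (rule holomorphic_near_0_prod)
    have "q * x + y = abs_hol_germ (\<lambda>z. ?m z * rep_hol_germ q z + rep_hol_germ y z)"
    proof -
      have "q * x + y = x * abs_hol_germ (rep_hol_germ q) + abs_hol_germ (rep_hol_germ y)"
        by (simp add: abs_rep_germ mult.commute)
      also have "x * abs_hol_germ (rep_hol_germ q) = abs_hol_germ (\<lambda>z. ?m z * rep_hol_germ q z)"
        unfolding c(2) monomial_germ_ring using m q by (intro times_hol_germ.abs_eq) (auto simp: germ_rel_self)
      also have "\<dots> + abs_hol_germ (rep_hol_germ y) =
          abs_hol_germ (\<lambda>z. ?m z * rep_hol_germ q z + rep_hol_germ y z)"
        using m q y by (intro plus_hol_germ.abs_eq) (auto simp: germ_rel_self holomorphic_near_0_mult)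
      finally show ?thesis .
    qed
    then have "germ_rel (rep_hol_germ (q * x + y)) (\<lambda>z. ?m z * rep_hol_germ q z + rep_hol_germ y z)"
      using m q y by (simp add: germ_rel_rep_abs holomorphic_near_0_add holomorphic_near_0_mult)
    moreover have "torus_small ?N b (\<lambda>z. ?m z * rep_hol_germ q z + rep_hol_germ y z)"
      using torus_small_multiple[where b = b and c = c and l = l, OF q l] step by (intro torus_small_add)
    ultimately show ?case
      using torus_small_germ_rel by blast
  qed
  then have "torus_small ?N b (rep_hol_germ (abs_hol_germ (\<lambda>z. \<Prod>i\<in>UNIV. z $ i ^ b i)))"
    using mem unfolding monomial_germ_ring[of b] by blast
  moreover have "germ_rel (rep_hol_germ (abs_hol_germ (\<lambda>z. \<Prod>i\<in>UNIV. z $ i ^ b i))) (\<lambda>z. \<Prod>i\<in>UNIV. z $ i ^ b i)"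
    by (rule germ_rel_rep_abs[OF holomorphic_near_0_prod])
  ultimately have "torus_small ?N b (\<lambda>z. \<Prod>i\<in>UNIV. z $ i ^ b i)"
    using torus_small_germ_rel by blast
  then show False using not_torus_small_monomial[of b] by blast
qed

interpretation germ_ring: coord_ring_laws "germ_ring :: ('n::{finite,linorder}, 'n hol_germ) coord_ring"
proof
  have scalar: "germ_scalar c = abs_hol_germ (\<lambda>_. c)" for c
    by (simp add: germ_scalar_def)
  have of_int: "germ_scalar (of_int k) = (of_int k :: 'n hol_germ)" for k
  proof (rule of_int_homomorphism)
    show "germ_scalar 1 = (1 :: 'n hol_germ)" by (simp add: scalar one_hol_germ_def)
    show "germ_scalar (x + y) = (germ_scalar x + germ_scalar y :: 'n hol_germ)" for x y
      unfolding scalar by (intro plus_hol_germ.abs_eq[symmetric]) (auto simp: germ_rel_self holomorphic_near_0_const)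
  qed
  then show "scalar germ_ring (of_int k) = (of_int k :: 'n hol_germ)" for k
    by (simp add: germ_ring_def)
  show "pdiff germ_ring l 0 = (0 :: 'n hol_germ)" for l
    unfolding zero_hol_germ_def
    by (simp add: germ_ring_def) (rule germ_pdiff_abs; simp add: holomorphic_near_0_const)
  fix l :: 'n and m :: nat and e b :: "'n \<Rightarrow> nat" and B :: "('n \<Rightarrow> nat) set"
  have const_mult: "germ_scalar c * monomial germ_ring e = abs_hol_germ (\<lambda>z. c * (\<Prod>i\<in>UNIV. z $ i ^ e i))"
    for c and e :: "'n \<Rightarrow> nat"
    unfolding scalar monomial_germ_ring
    by (intro times_hol_germ.abs_eq) (auto simp: germ_rel_self holomorphic_near_0_const holomorphic_near_0_prod)
  let ?c = "(- 1) ^ m :: complex"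
  have "germ_pdiff l (germ_scalar ?c * monomial germ_ring e) =
      germ_scalar (?c * of_nat (e l)) * monomial germ_ring (e(l := e l - 1))"
    unfolding const_mult
  proof (rule germ_pdiff_abs)
    fix z :: "(complex, 'n) vec"
    let ?r = "\<Prod>i\<in>UNIV - {l}. z $ i ^ e i"
    have "(\<Prod>i\<in>UNIV. (\<chi> j. if j = l then w else z $ j) $ i ^ e i) = w ^ e l * ?r" for w
      by (subst prod.remove[of _ l]) (auto intro!: prod.cong)
    moreover have "((\<lambda>w. ?c * (w ^ e l * ?r)) has_field_derivative
        ?c * (of_nat (e l) * z $ l ^ (e l - 1) * ?r)) (at (z $ l))"
      by (auto intro!: derivative_eq_intros)
    moreover have "(\<Prod>i\<in>UNIV. z $ i ^ (e(l := e l - 1)) i) = z $ l ^ (e l - 1) * ?r"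
      by (subst prod.remove[of _ l]) (auto intro!: prod.cong)
    ultimately show "deriv (\<lambda>w. ?c * (\<Prod>i\<in>UNIV. (\<chi> j. if j = l then w else z $ j) $ i ^ e i)) (z $ l) =
        ?c * of_nat (e l) * (\<Prod>i\<in>UNIV. z $ i ^ (e(l := e l - 1)) i)"
      by (simp add: DERIV_imp_deriv mult.assoc)
  qed (intro holomorphic_near_0_mult holomorphic_near_0_const holomorphic_near_0_prod)+
  then show "pdiff germ_ring l ((- 1) ^ m * monomial germ_ring e) =
      (- 1) ^ m * of_nat (e l) * monomial germ_ring (e(l := e l - 1))"
    using of_int[of "(- 1) ^ m"] of_int[of "(- 1) ^ m * int (e l)"] by (simp add: germ_ring_def)
  show "monomial germ_ring b \<in> ideal_gen (monomial germ_ring ` B) \<longleftrightarrow> (\<exists>c\<in>B. c \<le> b)"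
    using monomial_mem_germ_ideal monomial_mem_ideal by blast
qed

theorem theorem1p1:
  fixes \<sigma> :: "'n::{finite,linorder} \<Rightarrow> 'n"
    and r :: nat and a :: "nat \<Rightarrow> 'n \<Rightarrow> nat"
    and M_poly :: "'n mpoly set" and M_germ :: "'n hol_germ set"
  assumes "\<sigma> permutes UNIV" and "artinian r a" and "generic r a"
  shows
    "(minimal_generators polynomial_ring M_poly r a \<longrightarrow>
        (let S = staircase polynomial_ring M_poly in
          bij_betw (\<lambda>I. exponent_vec (label a I)) (scarf_faces r a CARD('n)) (outer_corners S) \<and>
          (\<forall>I \<in> scarf_faces r a CARD('n).
             let \<alpha> = label a I in
             scarf_dform polynomial_ring \<sigma> r a I =
               form_smult
                 (scalar polynomial_ring
                    (of_real (of_int (scarf_sign a I) *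
                       measure lebesgue (staircase_part \<sigma> S (exponent_vec \<alpha>)))) *
                  monomial polynomial_ring (\<lambda>l. \<alpha> l - 1))
                 dz))) \<and>
     (minimal_generators germ_ring M_germ r a \<longrightarrow>
        (let S = staircase germ_ring M_germ in
          bij_betw (\<lambda>I. exponent_vec (label a I)) (scarf_faces r a CARD('n)) (outer_corners S) \<and>
          (\<forall>I \<in> scarf_faces r a CARD('n).
             let \<alpha> = label a I in
             scarf_dform germ_ring \<sigma> r a I =
               form_smult
                 (scalar germ_ring
                    (of_real (of_int (scarf_sign a I) *
                       measure lebesgue (staircase_part \<sigma> S (exponent_vec \<alpha>)))) *
                  monomial germ_ring (\<lambda>l. \<alpha> l - 1))
                 dz)))"
  unfolding Let_def
  using polynomial_ring.scarf_dform_eq_volume[OF assms] germ_ring.scarf_dform_eq_volume[OF assms]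
  by blast

end
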